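(* There is a randomized algorithm that, given an adjacency list of a $d$-regular $n$-vertex graph $G$, a vector $b\in\mathbb{R}^n$ orthogonal to the all-ones vector, vertices $u,v\in[n]$, and the scalars $\|b\|_0$, $\epsilon>0$, and $\mu_2=d-\lambda_2>0$, outputs $\hat\delta_{u,v}\in\mathbb{R}$ satisfying \[ \Pr\Big[\,|\hat\delta_{u,v}-\chi_{u,v}^\top L^+ b|\le \epsilon\cdot\max_{ij\in E}|x_i-x_j|\Big]\ \ge\ 1-\tfrac1s, \] where $x$ is any solution of $Lx=b$, in time $O(d\,\epsilon^{-2}s^3\log s)$ for $s=O\big(\tfrac{d}{\mu_2}\log(\epsilon^{-1}\tfrac{d}{\mu_2}\|b\|_0)\big)$.
   Context: $A$ is the adjacency matrix of $G$ with eigenvalues $d=\lambda_1\ge\lambda_2\ge\dots\ge\lambda_n$; the hypothesis $\mu_2=d-\lambda_2>0$ means $G$ is connected. $L=dI-A$ is the Laplacian of $G$ and $L^+$ its Moore–Penrose pseudo-inverse. $\chi_{u,v}=e_u-e_v$ where $e_i$ is the $i$-th standard basis vector, so $\chi_{u,v}^\top L^+b=x_u-x_v$ for any solution $x$ of $Lx=b$. $\|b\|_0$ is the number of non-zero coordinates of $b$.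
   Formalization: The argument of the logarithm in s is replaced by 2 when it is below 2 (b = 0 would give log 0, and large ε a non-positive s), and the time bound has an additive O(1), since for large ε the stated bound falls below one step. *)

theory Defs
  imports "HOL-Probability.Probability" "Jordan_Normal_Form.Char_Poly"
begin

no_notation vec_nth (infixl "$" 90)
no_notation inner (infix "\<bullet>" 70)

section \<open>Regular graphs and their matrices\<close>

text \<open>Vertices are \<open>0, \<dots>, n - 1\<close>, and an edge is a two-element set of vertices.\<close>

definition simple_graph :: "nat \<Rightarrow> nat set set \<Rightarrow> bool" where
  "simple_graph n E \<longleftrightarrow> E \<subseteq> {{i, j} | i j. i < n \<and> j < n \<and> i \<noteq> j}"

definition neighbours :: "nat set set \<Rightarrow> nat \<Rightarrow> nat set" where
  "neighbours E i = {j. {i, j} \<in> E}"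

definition regular_graph :: "nat \<Rightarrow> nat \<Rightarrow> nat set set \<Rightarrow> bool" where
  "regular_graph n d E \<longleftrightarrow> simple_graph n E \<and> (\<forall>i<n. card (neighbours E i) = d)"

definition is_adjacency_list :: "nat \<Rightarrow> nat set set \<Rightarrow> nat list list \<Rightarrow> bool" where
  "is_adjacency_list n E adj \<longleftrightarrow> length adj = n \<and>
     (\<forall>i<n. distinct (adj ! i) \<and> set (adj ! i) = neighbours E i)"

definition adjacency_matrix :: "nat \<Rightarrow> nat set set \<Rightarrow> real mat" where
  "adjacency_matrix n E = Matrix.mat n n (\<lambda>(i, j). if {i, j} \<in> E then 1 else 0)"

definition laplacian :: "nat \<Rightarrow> nat \<Rightarrow> nat set set \<Rightarrow> real mat" where
  "laplacian n d E = real d \<cdot>\<^sub>m 1\<^sub>m n - adjacency_matrix n E"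

text \<open>The real eigenvalues, with algebraic multiplicity, in decreasing order; for a symmetric
  \<open>n \<times> n\<close> matrix these are all \<open>n\<close> eigenvalues. Counting starts at 1.\<close>

definition eigenvalues_desc :: "real mat \<Rightarrow> real list" where
  "eigenvalues_desc A = rev (sorted_list_of_multiset (proots (char_poly A)))"

definition nth_eigenvalue :: "real mat \<Rightarrow> nat \<Rightarrow> real" where
  "nth_eigenvalue A k = eigenvalues_desc A ! (k - 1)"

definition is_pseudo_inverse :: "real mat \<Rightarrow> real mat \<Rightarrow> bool" where
  "is_pseudo_inverse A X \<longleftrightarrow> X \<in> carrier_mat (dim_col A) (dim_row A) \<and>
     A * X * A = A \<and> X * A * X = X \<and>
     transpose_mat (A * X) = A * X \<and> transpose_mat (X * A) = X * A"

definition pseudo_inverse :: "real mat \<Rightarrow> real mat" where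
  "pseudo_inverse A = (THE X. is_pseudo_inverse A X)"

definition all_ones :: "nat \<Rightarrow> real Matrix.vec" where
  "all_ones n = Matrix.vec n (\<lambda>_. 1)"

definition chi :: "nat \<Rightarrow> nat \<Rightarrow> nat \<Rightarrow> real Matrix.vec" where
  "chi n u v = unit_vec n u - unit_vec n v"

definition nnz :: "real Matrix.vec \<Rightarrow> nat" where
  "nnz b = card {i. i < dim_vec b \<and> b $ i \<noteq> 0}"

definition max_edge_diff :: "nat set set \<Rightarrow> real Matrix.vec \<Rightarrow> real" where
  "max_edge_diff E x = Max {\<bar>x $ i - x $ j\<bar> | i j. {i, j} \<in> E}"

section \<open>Randomized algorithms\<close>

text \<open>
  Randomized algorithms are programs for a randomized real RAM with natural-number registers
  \<open>N 0, N 1, \<dots>\<close> and real registers \<open>R 0, R 1, \<dots>\<close>, which has read-only access to an adjacency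
  list and to the coordinates of a vector. A program is a finite piece of syntax, independent of
  the input (in particular of the size of the graph). There is no indirect addressing, so a program
  uses a constant number of registers; natural numbers can only be added, subtracted (with
  truncation at 0) and compared. Real arithmetic and \<open>ln\<close> are exact, as in the real RAM of
  Preparata and Shamos.

  The length of each vertex's list is stored with the list, and each list is linked: the entry with
  index \<open>k\<close> (counting from 0) is reached by following the list, at cost \<open>k + 1\<close>. Every other
  operation, including drawing a uniform random number below a given bound, costs 1.
\<close>

datatype instr =
    NConst nat nat      \<comment> \<open>\<open>N i := c\<close>\<close>
  | NAdd nat nat nat    \<comment> \<open>\<open>N i := N j + N k\<close>\<close>
  | NSub nat nat nat
  | RConst nat int      \<comment> \<open>\<open>R i := c\<close>\<close>
  | RAdd nat nat nat    \<comment> \<open>\<open>R i := R j + R k\<close>\<close>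
  | RSub nat nat nat
  | RMul nat nat nat
  | RDiv nat nat nat
  | RLn nat nat         \<comment> \<open>\<open>R i := ln (R j)\<close>\<close>
  | RNat nat nat        \<comment> \<open>\<open>R i := N j\<close>\<close>
  | Deg nat nat         \<comment> \<open>\<open>N i :=\<close> length of the list of vertex \<open>N j\<close>\<close>
  | Nbr nat nat nat     \<comment> \<open>\<open>N i :=\<close> entry with index \<open>N k\<close> in the list of vertex \<open>N j\<close>\<close>
  | Entry nat nat       \<comment> \<open>\<open>R i :=\<close> coordinate \<open>N j\<close> of the vector\<close>
  | Rand nat nat        \<comment> \<open>\<open>N i :=\<close> uniform random element of \<open>{..<N j}\<close>\<close>

datatype test =
    NLess nat nat       \<comment> \<open>\<open>N i < N j\<close>\<close>
  | RLess nat nat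

datatype cmd =
    Do instr
  | IfElse test "cmd list" "cmd list"
  | WhileDo test "cmd list"

type_synonym prog = "cmd list"
type_synonym store = "(nat \<Rightarrow> nat) \<times> (nat \<Rightarrow> real)"

fun holds :: "test \<Rightarrow> store \<Rightarrow> bool" where
  "holds (NLess i j) (N, R) \<longleftrightarrow> N i < N j"
| "holds (RLess i j) (N, R) \<longleftrightarrow> R i < R j"

text \<open>Reads outside the input return 0, as does a random choice from the empty range.\<close>

fun exec_instr :: "nat list list \<Rightarrow> real Matrix.vec \<Rightarrow> instr \<Rightarrow> store \<Rightarrow> store pmf" where
  "exec_instr adj b (NConst i c) (N, R) = return_pmf (N(i := c), R)"
| "exec_instr adj b (NAdd i j k) (N, R) = return_pmf (N(i := N j + N k), R)"
| "exec_instr adj b (NSub i j k) (N, R) = return_pmf (N(i := N j - N k), R)"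
| "exec_instr adj b (RConst i c) (N, R) = return_pmf (N, R(i := of_int c))"
| "exec_instr adj b (RAdd i j k) (N, R) = return_pmf (N, R(i := R j + R k))"
| "exec_instr adj b (RSub i j k) (N, R) = return_pmf (N, R(i := R j - R k))"
| "exec_instr adj b (RMul i j k) (N, R) = return_pmf (N, R(i := R j * R k))"
| "exec_instr adj b (RDiv i j k) (N, R) = return_pmf (N, R(i := R j / R k))"
| "exec_instr adj b (RLn i j) (N, R) = return_pmf (N, R(i := ln (R j)))"
| "exec_instr adj b (RNat i j) (N, R) = return_pmf (N, R(i := real (N j)))"
| "exec_instr adj b (Deg i j) (N, R) =
     return_pmf (N(i := if N j < length adj then length (adj ! N j) else 0), R)"
| "exec_instr adj b (Nbr i j k) (N, R) =
     return_pmf (N(i := if N j < length adj \<and> N k < length (adj ! N j)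
                        then adj ! N j ! N k else 0), R)"
| "exec_instr adj b (Entry i j) (N, R) =
     return_pmf (N, R(i := if N j < dim_vec b then b $ N j else 0))"
| "exec_instr adj b (Rand i j) (N, R) =
     (if N j = 0 then return_pmf (N(i := 0), R)
      else map_pmf (\<lambda>r. (N(i := r), R)) (pmf_of_set {..<N j}))"

fun cost :: "instr \<Rightarrow> store \<Rightarrow> nat" where
  "cost (Nbr i j k) (N, R) = N k + 1"
| "cost _ _ = 1"

text \<open>A configuration consists of the commands still to be executed, the store and the time
  spent so far.\<close>

type_synonym config = "prog \<times> store \<times> nat"

fun step :: "nat list list \<Rightarrow> real Matrix.vec \<Rightarrow> config \<Rightarrow> config pmf" where
  "step adj b ([], \<sigma>, t) = return_pmf ([], \<sigma>, t)"
| "step adj b (Do c # cs, \<sigma>, t) = map_pmf (\<lambda>\<sigma>'. (cs, \<sigma>', t + cost c \<sigma>)) (exec_instr adj b c \<sigma>)"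
| "step adj b (IfElse p xs ys # cs, \<sigma>, t) =
     return_pmf ((if holds p \<sigma> then xs else ys) @ cs, \<sigma>, t + 1)"
| "step adj b (WhileDo p xs # cs, \<sigma>, t) =
     return_pmf (if holds p \<sigma> then xs @ WhileDo p xs # cs else cs, \<sigma>, t + 1)"

fun run :: "nat list list \<Rightarrow> real Matrix.vec \<Rightarrow> nat \<Rightarrow> config \<Rightarrow> config pmf" where
  "run adj b 0 c = return_pmf c"
| "run adj b (Suc k) c = bind_pmf (step adj b c) (run adj b k)"

text \<open>The scalar inputs are \<open>u, v, m\<close> (natural numbers) and \<open>\<epsilon>, \<mu>\<close> (reals); the output is read
  from \<open>R 0\<close>.\<close>

definition init_store :: "nat \<Rightarrow> nat \<Rightarrow> nat \<Rightarrow> real \<Rightarrow> real \<Rightarrow> store" where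
  "init_store u v m \<epsilon> \<mu> = ((\<lambda>_. 0)(0 := u, 1 := v, 2 := m), (\<lambda>_. 0)(0 := \<epsilon>, 1 := \<mu>))"

text \<open>Whatever the random choices, \<open>P\<close> started in \<open>\<sigma>\<close> halts within time \<open>T\<close>, and its output has
  distribution \<open>D\<close>. Halted configurations are fixed points of \<open>step\<close>, so \<open>D\<close> does not depend
  on the choice of \<open>k\<close>.\<close>

definition computes_within ::
  "nat list list \<Rightarrow> real Matrix.vec \<Rightarrow> prog \<Rightarrow> store \<Rightarrow> real \<Rightarrow> real pmf \<Rightarrow> bool" where
  "computes_within adj b P \<sigma> T D \<longleftrightarrow>
     (\<exists>k. (\<forall>(cs, \<sigma>', t) \<in> set_pmf (run adj b k (P, \<sigma>, 0)). cs = [] \<and> real t \<le> T) \<and>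
          D = map_pmf (\<lambda>(cs, (N, R), t). R 0) (run adj b k (P, \<sigma>, 0)))"

text \<open>The parameter \<open>s\<close> with \<open>C\<close> as the constant in its \<open>O\<close>. The argument \<open>\<epsilon>\<inverse> (d/\<mu>) m\<close> of the
  logarithm is replaced by 2 when it is smaller, since there the logarithm would tend to 0 or be
  negative, or undefined if \<open>m = 0\<close>, whereas \<open>s\<close> has to be a positive integer.\<close>

definition s_param :: "real \<Rightarrow> nat \<Rightarrow> real \<Rightarrow> real \<Rightarrow> nat \<Rightarrow> nat" where
  "s_param C d \<mu> \<epsilon> m =
     nat \<lceil>C * (real d / \<mu>) * ln (max 2 (inverse \<epsilon> * (real d / \<mu>) * real m))\<rceil>"

end

theory Submission
  imports Defs
begin

text \<open>
  Let \<open>W = (I + A/d) / 2\<close> be the lazy random walk, so that \<open>L = 2 d (I - W)\<close>. If \<open>L x = b\<close> with \<open>x\<close>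
  orthogonal to the constants, then \<open>1 / (2 d) (\<Sum>t<s. W\<^sup>t b) = x - W\<^sup>s x\<close>, so the sum of
  \<open>b\<close> along walks of length \<open>s\<close> started in \<open>u\<close> and \<open>v\<close> estimates \<open>x\<^sub>u - x\<^sub>v\<close> without
  bias up to \<open>2 \<parallel>W\<^sup>s x\<parallel>\<close>. Since \<open>W\<close> is positive semidefinite with norm \<open>1 - \<mu>\<^sub>2 / (2 d)\<close> on the
  mean-zero vectors and \<open>\<parallel>x\<parallel> \<le> \<parallel>b\<parallel> / \<mu>\<^sub>2\<close>, the bias is at most half of the permitted error. With \<open>M\<close>
  the largest difference along an edge, \<open>\<bar>b\<^sub>i\<bar> \<le> d M\<close>, so one sample is bounded by \<open>s M\<close>, and
  Hoeffding's inequality shows that \<open>O(s\<^sup>2 log s / \<epsilon>\<^sup>2)\<close> samples suffice. If this number is below 1,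
  then \<open>\<epsilon>\<close> is so large that 0 is a correct answer.
\<close>

section \<open>Quadratic forms on mean-zero vectors\<close>

text \<open>Laziness is needed because \<open>A\<close> may have eigenvalues near \<open>-d\<close>
  (bipartite graphs attain \<open>-d\<close>), which the gap does not control. Since
  \<open>(I + A/d) / 2\<close> is positive semidefinite, an upper bound for its form on the
  mean-zero vectors also bounds its norm there. The second eigenvalue is given as an entry of a
  sorted list of roots of the characteristic polynomial and has to be tied to a quadratic form. No
  eigenbasis is built for this: all that is required is an upper bound for the form of
  \<open>A\<close> on mean-zero vectors, and it suffices that the best constant in such a bound is
  an eigenvalue. The answer 0 without sampling is forced by the time bound: for large \<epsilon> the
  bound drops below the order \<open>d s\<close> of the cost of a single walk. The factor
  \<open>d\<close> comes from following a linked neighbour list in each step.\<close>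

definition ip :: "nat \<Rightarrow> (nat \<Rightarrow> real) \<Rightarrow> (nat \<Rightarrow> real) \<Rightarrow> real" where
  "ip n x y = (\<Sum>i<n. x i * y i)"

definition mv :: "nat \<Rightarrow> (nat \<Rightarrow> nat \<Rightarrow> real) \<Rightarrow> (nat \<Rightarrow> real) \<Rightarrow> nat \<Rightarrow> real" where
  "mv n a x i = (\<Sum>j<n. a i j * x j)"

lemma ip_commute: "ip n x y = ip n y x"
  by (simp add: ip_def mult.commute)

lemma ip_self_nonneg: "0 \<le> ip n x x"
  by (simp add: ip_def sum_nonneg)

lemma ip_cong:
  "(\<And>i. i < n \<Longrightarrow> x i = x' i) \<Longrightarrow> (\<And>i. i < n \<Longrightarrow> y i = y' i) \<Longrightarrow> ip n x y = ip n x' y'"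
  by (simp add: ip_def)

lemma component_sq_le_ip: "i < n \<Longrightarrow> (x i)\<^sup>2 \<le> ip n x x"
  unfolding ip_def power2_eq_square by (rule member_le_sum) auto

lemma ip_self_eq_0_iff: "ip n x x = 0 \<longleftrightarrow> (\<forall>i<n. x i = 0)"
  by (auto simp: ip_def sum_nonneg_eq_0_iff)

lemma ip_mv_commute:
  assumes "\<And>i j. i < n \<Longrightarrow> j < n \<Longrightarrow> a i j = a j i"
  shows "ip n x (mv n a y) = ip n (mv n a x) y"
proof -
  have "ip n x (mv n a y) = (\<Sum>i<n. \<Sum>j<n. a i j * x i * y j)"
    by (simp add: ip_def mv_def sum_distrib_left mult_ac)
  also have "\<dots> = (\<Sum>j<n. \<Sum>i<n. a i j * x i * y j)"
    by (rule sum.swap)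
  also have "\<dots> = (\<Sum>j<n. \<Sum>i<n. a j i * x i * y j)"
    using assms by simp
  also have "\<dots> = ip n (mv n a x) y"
    by (simp add: ip_def mv_def sum_distrib_right)
  finally show ?thesis .
qed

text \<open>The polynomial is evaluated at its vertex \<open>- b / c\<close>. If
  \<open>c = 0\<close>, a nonzero \<open>b\<close> would give the value -1 at
  \<open>- (a + 1) / (2 * b)\<close>.\<close>

lemma discriminant_nonpos:
  fixes a b c :: real
  assumes "0 \<le> c" and "\<And>t. 0 \<le> a + 2 * b * t + c * t\<^sup>2"
  shows "b\<^sup>2 \<le> a * c"
proof (cases "c = 0")
  case True
  have "b = 0"
  proof (rule ccontr)
    assume "b \<noteq> 0"
    with assms(2)[of "- (a + 1) / (2 * b)"] True show False by simp
  qed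
  with True show ?thesis by simp
next
  case False
  with \<open>0 \<le> c\<close> have c: "c > 0" by simp
  have "0 \<le> a - b\<^sup>2 / c"
    using assms(2)[of "- b / c"] c by (simp add: field_simps power2_eq_square)
  with c show ?thesis by (simp add: field_simps)
qed

text \<open>Semidefiniteness is available only on the mean-zero vectors. They are closed under
  forming \<open>x + t y\<close>, so the discriminant argument along this line survives the
  restriction.\<close>

lemma psd_Cauchy_Schwarz:
  assumes sym: "\<And>i j. i < n \<Longrightarrow> j < n \<Longrightarrow> a i j = a j i"
    and psd: "\<And>z. (\<Sum>i<n. z i) = 0 \<Longrightarrow> 0 \<le> ip n z (mv n a z)"
    and x: "(\<Sum>i<n. x i) = 0" and y: "(\<Sum>i<n. y i) = 0"
  shows "(ip n x (mv n a y))\<^sup>2 \<le> ip n x (mv n a x) * ip n y (mv n a y)"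
proof (rule discriminant_nonpos)
  show "0 \<le> ip n y (mv n a y)" by (rule psd[OF y])
next
  fix t :: real
  have "(\<Sum>i<n. x i + t * y i) = 0"
    using x y by (simp add: sum.distrib flip: sum_distrib_left)
  from psd[OF this] have "0 \<le> ip n (\<lambda>i. x i + t * y i) (mv n a (\<lambda>i. x i + t * y i))" .
  also have "mv n a (\<lambda>i. x i + t * y i) = (\<lambda>i. mv n a x i + t * mv n a y i)"
    by (simp add: mv_def fun_eq_iff algebra_simps sum.distrib sum_distrib_left)
  also have "ip n (\<lambda>i. x i + t * y i) (\<lambda>i. mv n a x i + t * mv n a y i)
      = ip n x (mv n a x) + t * ip n x (mv n a y) + t * ip n y (mv n a x) + t\<^sup>2 * ip n y (mv n a y)"
    by (simp add: ip_def algebra_simps sum.distrib sum_distrib_left power2_eq_square)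
  also have "ip n y (mv n a x) = ip n x (mv n a y)"
    using ip_mv_commute[of n a y x] sym by (simp add: ip_commute)
  finally show "0 \<le> ip n x (mv n a x) + 2 * ip n x (mv n a y) * t + ip n y (mv n a y) * t\<^sup>2"
    by (simp add: algebra_simps)
qed

text \<open>Applying the Cauchy-Schwarz inequality of the form to \<open>x\<close> and \<open>z = a x\<close> gives
  \<open>\<parallel>z\<parallel>\<^sup>4 \<le> \<langle>x, a x\<rangle> \<langle>z, a z\<rangle> \<le> \<langle>x, a x\<rangle> \<beta> \<parallel>z\<parallel>\<^sup>2\<close>.\<close>
lemma psd_norm_image_le:
  assumes sym: "\<And>i j. i < n \<Longrightarrow> j < n \<Longrightarrow> a i j = a j i"
    and psd: "\<And>z. (\<Sum>i<n. z i) = 0 \<Longrightarrow> 0 \<le> ip n z (mv n a z)"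
    and upper: "\<And>z. (\<Sum>i<n. z i) = 0 \<Longrightarrow> ip n z (mv n a z) \<le> \<beta> * ip n z z"
    and x: "(\<Sum>i<n. x i) = 0" and ax: "(\<Sum>i<n. mv n a x i) = 0"
  shows "ip n (mv n a x) (mv n a x) \<le> \<beta> * ip n x (mv n a x)"
proof -
  define z where "z = mv n a x"
  have z: "(\<Sum>i<n. z i) = 0" using ax by (simp add: z_def)
  have "(ip n z z)\<^sup>2 = (ip n x (mv n a z))\<^sup>2"
    using ip_mv_commute[of n a x z] sym by (simp add: z_def)
  also have "\<dots> \<le> ip n x (mv n a x) * ip n z (mv n a z)"
    by (rule psd_Cauchy_Schwarz[OF sym psd x z])
  also have "\<dots> \<le> ip n x (mv n a x) * (\<beta> * ip n z z)"
    by (intro mult_left_mono upper z psd x)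
  finally have "ip n z z * ip n z z \<le> \<beta> * ip n x (mv n a x) * ip n z z"
    by (simp add: power2_eq_square mult_ac)
  \<comment> \<open>If \<open>z = 0\<close>, nothing can be cancelled and the sign of \<beta> is
    unknown, but then the product of \<open>x\<close> and \<open>z\<close> vanishes.\<close>
  moreover have "0 \<le> \<beta> * ip n x (mv n a x)" if "ip n z z = 0"
  proof -
    have "\<forall>i<n. z i = 0" using that by (simp add: ip_self_eq_0_iff)
    hence "ip n x (mv n a x) = 0" by (simp add: ip_def z_def)
    thus ?thesis by simp
  qed
  ultimately have "ip n z z \<le> \<beta> * ip n x (mv n a x)"
    using ip_self_nonneg[of n z] by (cases "ip n z z = 0") (auto simp: mult_le_cancel_right)
  thus ?thesis by (simp add: z_def)
qed

section \<open>Invertibility and optimal Rayleigh bounds\<close>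

lemma injective_mat_inverse:
  fixes M :: "real mat"
  assumes M: "M \<in> carrier_mat n n"
    and inj: "\<And>v. v \<in> carrier_vec n \<Longrightarrow> M *\<^sub>v v = 0\<^sub>v n \<Longrightarrow> v = 0\<^sub>v n"
  obtains B where "B \<in> carrier_mat n n" "B * M = 1\<^sub>m n" "M * B = 1\<^sub>m n"
proof -
  have "Determinant.det M \<noteq> 0"
    using det_0_iff_vec_prod_zero_field[OF M] inj by blast
  from det_non_zero_imp_unit[OF M this, of "()"] that show thesis
    by (auto simp: Units_def ring_mat_def)
qed

lemma mult_mat_vec_index:
  "A \<in> carrier_mat n m \<Longrightarrow> v \<in> carrier_vec m \<Longrightarrow> i < n \<Longrightarrow>
    (A *\<^sub>v v) $ i = (\<Sum>j<m. A $$ (i, j) * v $ j)"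
  by (simp add: scalar_prod_def lessThan_atLeast0)

text \<open>An injective square matrix has an inverse \<open>B\<close>, and Cauchy-Schwarz in each
  row of \<open>x = B (m x)\<close> yields the squared Frobenius norm \<open>F\<close> of
  \<open>B\<close> as a constant. \<open>F + 1\<close> is positive even if
  \<open>F = 0\<close>.\<close>

lemma injective_bounded_below:
  assumes inj: "\<And>x. (\<And>i. i < n \<Longrightarrow> mv n m x i = 0) \<Longrightarrow> (\<And>i. i < n \<Longrightarrow> x i = 0)"
  obtains K where "K > 0" "\<And>x. ip n x x \<le> K * ip n (mv n m x) (mv n m x)"
proof -
  define M where "M = Matrix.mat n n (\<lambda>(i, j). m i j)"
  have M: "M \<in> carrier_mat n n" by (simp add: M_def)
  have Mv: "(M *\<^sub>v v) $ i = mv n m (($) v) i" if "v \<in> carrier_vec n" "i < n" for v i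
    using mult_mat_vec_index[OF M that] that by (simp add: M_def mv_def)
  obtain B where B: "B \<in> carrier_mat n n" and BM: "B * M = 1\<^sub>m n"
  proof (rule injective_mat_inverse[OF M])
    fix v assume v: "v \<in> carrier_vec n" and z: "M *\<^sub>v v = 0\<^sub>v n"
    have "v $ i = 0" if "i < n" for i
      using inj[of "($) v" i] Mv[OF v] z that by simp
    thus "v = 0\<^sub>v n" using v by auto
  qed
  define F where "F = (\<Sum>i<n. \<Sum>j<n. (B $$ (i, j))\<^sup>2)"
  have F0: "0 \<le> F" by (simp add: F_def sum_nonneg)
  have "ip n x x \<le> (F + 1) * ip n (mv n m x) (mv n m x)" for x
  proof -
    define v where "v = Matrix.vec n x"
    have v: "v \<in> carrier_vec n" by (simp add: v_def)
    have Bx: "x i = (\<Sum>j<n. B $$ (i, j) * mv n m x j)" if "i < n" for i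
    proof -
      have "x i = (1\<^sub>m n *\<^sub>v v) $ i" using that by (simp add: v_def)
      also have "\<dots> = (B *\<^sub>v (M *\<^sub>v v)) $ i"
        using assoc_mult_mat_vec[OF B M v] BM by simp
      also have "\<dots> = (\<Sum>j<n. B $$ (i, j) * (M *\<^sub>v v) $ j)"
        using mult_mat_vec_index[OF B _ that] M v by simp
      also have "\<dots> = (\<Sum>j<n. B $$ (i, j) * mv n m x j)"
        using Mv[OF v] by (intro sum.cong) (auto simp: mv_def v_def)
      finally show ?thesis .
    qed
    have "ip n x x = (\<Sum>i<n. (\<Sum>j<n. B $$ (i, j) * mv n m x j)\<^sup>2)"
      unfolding ip_def power2_eq_square using Bx by (intro sum.cong) auto
    also have "\<dots> \<le> (\<Sum>i<n. (\<Sum>j<n. (B $$ (i, j))\<^sup>2) * (\<Sum>j<n. (mv n m x j)\<^sup>2))"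
      by (intro sum_mono Cauchy_Schwarz_ineq_sum)
    also have "\<dots> = F * ip n (mv n m x) (mv n m x)"
      by (simp add: F_def ip_def power2_eq_square sum_distrib_right)
    also have "\<dots> \<le> (F + 1) * ip n (mv n m x) (mv n m x)"
      by (intro mult_right_mono ip_self_nonneg) auto
    finally show ?thesis .
  qed
  with F0 that[of "F + 1"] show thesis by simp
qed

lemma sum_mv:
  assumes sym: "\<And>i j. i < n \<Longrightarrow> j < n \<Longrightarrow> a i j = a j i"
    and rows: "\<And>i. i < n \<Longrightarrow> (\<Sum>j<n. a i j) = c"
  shows "(\<Sum>i<n. mv n a x i) = c * (\<Sum>i<n. x i)"
proof -
  have "(\<Sum>i<n. mv n a x i) = (\<Sum>j<n. (\<Sum>i<n. a i j) * x j)"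
    unfolding mv_def by (subst sum.swap) (simp add: sum_distrib_right)
  also have "\<dots> = (\<Sum>j<n. (\<Sum>i<n. a j i) * x j)"
    using sym by simp
  finally show ?thesis using rows by (simp add: sum_distrib_left)
qed

lemma ip_mv_abs_le:
  "\<bar>ip n x (mv n a x)\<bar> \<le> (\<Sum>i<n. \<Sum>j<n. \<bar>a i j\<bar>) * ip n x x"
proof -
  have "\<bar>ip n x (mv n a x)\<bar> \<le> (\<Sum>i<n. \<Sum>j<n. \<bar>x i * (a i j * x j)\<bar>)"
    unfolding ip_def mv_def sum_distrib_left
    by (intro order_trans[OF sum_abs] sum_mono sum_abs)
  also have "\<dots> \<le> (\<Sum>i<n. \<Sum>j<n. \<bar>a i j\<bar> * ip n x x)"
  proof (intro sum_mono)
    fix i j assume ij: "i \<in> {..<n}" "j \<in> {..<n}"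
    have "2 * (\<bar>x i\<bar> * \<bar>x j\<bar>) \<le> (x i)\<^sup>2 + (x j)\<^sup>2"
      using sum_squares_bound[of "\<bar>x i\<bar>" "\<bar>x j\<bar>"] by simp
    also have "\<dots> \<le> 2 * ip n x x"
      using component_sq_le_ip[of _ n x] ij by (smt (verit) lessThan_iff)
    finally have "\<bar>a i j\<bar> * (\<bar>x i\<bar> * \<bar>x j\<bar>) \<le> \<bar>a i j\<bar> * ip n x x"
      by (intro mult_left_mono) auto
    thus "\<bar>x i * (a i j * x j)\<bar> \<le> \<bar>a i j\<bar> * ip n x x"
      by (simp add: abs_mult mult_ac)
  qed
  finally show ?thesis by (simp add: sum_distrib_right)
qed

lemma mean_zero_vector_exists:
  assumes n: "2 \<le> n"
  obtains e where "(\<Sum>i<n. e i) = 0" "ip n e e = 2"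
proof -
  define e where "e = (\<lambda>i::nat. if i = 0 then 1 else if i = 1 then - 1 else (0::real))"
  have e: "(\<Sum>i<n. e i) = 0" "ip n e e = 2"
  proof -
    have "(\<Sum>i<n. e i) = (\<Sum>i\<in>{0,1}. e i)"
      using n by (intro sum.mono_neutral_right) (auto simp: e_def)
    thus "(\<Sum>i<n. e i) = 0" by (simp add: e_def)
    have "(\<Sum>i<n. e i * e i) = (\<Sum>i\<in>{0,1}. e i * e i)"
      using n by (intro sum.mono_neutral_right) (auto simp: e_def)
    thus "ip n e e = 2" by (simp add: e_def ip_def)
  qed
  with that show thesis by blast
qed

text \<open>The infimum of the admissible constants takes the place of a maximiser on the unit
  sphere, so compactness is avoided. The set is bounded below because a nonzero mean-zero vector
  exists once \<open>2 \<le> n\<close>.\<close>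

lemma exists_best_Rayleigh_bound:
  assumes n: "2 \<le> n"
  obtains \<nu> where "\<And>x. (\<Sum>i<n. x i) = 0 \<Longrightarrow> ip n x (mv n a x) \<le> \<nu> * ip n x x"
    "\<And>c. (\<And>x. (\<Sum>i<n. x i) = 0 \<Longrightarrow> ip n x (mv n a x) \<le> c * ip n x x) \<Longrightarrow> \<nu> \<le> c"
proof -
  define \<beta> where "\<beta> = (\<Sum>i<n. \<Sum>j<n. \<bar>a i j\<bar>)"
  define C where "C = {c. \<forall>x. (\<Sum>i<n. x i) = 0 \<longrightarrow> ip n x (mv n a x) \<le> c * ip n x x}"
  have "\<beta> \<in> C"
    using ip_mv_abs_le[of n _ a] by (auto simp: C_def \<beta>_def abs_le_iff)
  obtain e where e: "(\<Sum>i<n. e i) = 0" "ip n e e = 2"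
    using mean_zero_vector_exists[OF n] by blast
  have "- \<beta> \<le> c" if "c \<in> C" for c
    using that e ip_mv_abs_le[of n e a] by (force simp: C_def \<beta>_def abs_le_iff)
  hence bdd: "bdd_below C" by (auto simp: bdd_below_def)
  have "ip n x (mv n a x) \<le> Inf C * ip n x x" if x: "(\<Sum>i<n. x i) = 0" for x
  proof (cases "ip n x x = 0")
    case True
    with \<open>\<beta> \<in> C\<close> x show ?thesis by (force simp: C_def)
  next
    case False
    with ip_self_nonneg[of n x] have pos: "ip n x x > 0" by simp
    \<comment> \<open>Every admissible constant is at least this quotient, so the quotient is a
      lower bound of \<open>C\<close>.\<close>
    have "ip n x (mv n a x) / ip n x x \<le> Inf C"
      using \<open>\<beta> \<in> C\<close> x pos by (intro cInf_greatest) (auto simp: C_def divide_simps)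
    with pos show ?thesis by (simp add: divide_simps)
  qed
  moreover have "Inf C \<le> c"
    if "\<And>x. (\<Sum>i<n. x i) = 0 \<Longrightarrow> ip n x (mv n a x) \<le> c * ip n x x" for c
    using that by (intro cInf_lower bdd) (auto simp: C_def)
  ultimately show thesis using that by blast
qed

text \<open>If \<open>\<nu> - a\<close> were injective on the mean-zero vectors, then it would be bounded below there, and
  the optimal Rayleigh bound \<open>\<nu>\<close> could be lowered. The rank-one term \<open>\<gamma>\<close> makes \<open>\<nu> - a\<close>
  injective on the constants as well.\<close>
lemma Rayleigh_eigenvector:
  assumes n: "2 \<le> n"
    and sym: "\<And>i j. i < n \<Longrightarrow> j < n \<Longrightarrow> a i j = a j i"
    and rows: "\<And>i. i < n \<Longrightarrow> (\<Sum>j<n. a i j) = d"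
  obtains \<nu> y where "(\<Sum>i<n. y i) = 0" "\<exists>i<n. y i \<noteq> 0"
    "\<And>i. i < n \<Longrightarrow> mv n a y i = \<nu> * y i"
    "\<And>x. (\<Sum>i<n. x i) = 0 \<Longrightarrow> ip n x (mv n a x) \<le> \<nu> * ip n x x"
proof -
  obtain \<nu> where \<nu>: "\<And>x. (\<Sum>i<n. x i) = 0 \<Longrightarrow> ip n x (mv n a x) \<le> \<nu> * ip n x x"
    and min: "\<And>c. (\<And>x. (\<Sum>i<n. x i) = 0 \<Longrightarrow> ip n x (mv n a x) \<le> c * ip n x x) \<Longrightarrow> \<nu> \<le> c"
    using exists_best_Rayleigh_bound[OF n] by blast
  \<comment> \<open>With this value the entries of \<open>m' x\<close> have the same sum as those of
    \<open>x\<close>, so every vector in the kernel of \<open>m'\<close> is mean-zero, and on such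
    vectors \<open>m'\<close> and \<open>m\<close> agree.\<close>
  define \<gamma> where "\<gamma> = (d - \<nu> + 1) / n"
  define m where "m = (\<lambda>i j. (if i = j then \<nu> else 0) - a i j)"
  define m' where "m' = (\<lambda>i j. m i j + \<gamma>)"
  have m_mv: "mv n m x i = \<nu> * x i - mv n a x i" if "i < n" for x i
  proof -
    have "mv n m x i = (\<Sum>j<n. (if i = j then \<nu> * x j else 0)) - mv n a x i"
      unfolding mv_def m_def sum_subtractf[symmetric] by (intro sum.cong) (auto simp: algebra_simps)
    thus ?thesis using that by simp
  qed
  have m'_mv: "mv n m' x i = mv n m x i + \<gamma> * (\<Sum>j<n. x j)" for x i
    by (simp add: mv_def m'_def algebra_simps sum.distrib sum_distrib_left)
  have sum_m: "(\<Sum>i<n. mv n m x i) = (\<nu> - d) * (\<Sum>i<n. x i)" for x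
    using sum_mv[of n a d x] sym rows by (simp add: m_mv sum_subtractf algebra_simps sum_distrib_left)
  have "\<exists>x. (\<forall>i<n. mv n m' x i = 0) \<and> (\<exists>i<n. x i \<noteq> 0)"
  proof (rule ccontr)
    assume "\<not> ?thesis"
    hence inj: "\<And>x i. (\<And>i. i < n \<Longrightarrow> mv n m' x i = 0) \<Longrightarrow> i < n \<Longrightarrow> x i = 0" by blast
    obtain K where K: "K > 0" "\<And>x. ip n x x \<le> K * ip n (mv n m' x) (mv n m' x)"
      by (rule injective_bounded_below[of n m']) (use inj in blast)+
    have ip_m: "ip n x (mv n m x) = \<nu> * ip n x x - ip n x (mv n a x)" for x
    proof -
      have "ip n x (mv n m x) = ip n x (\<lambda>i. \<nu> * x i - mv n a x i)"
        by (intro ip_cong) (auto simp: m_mv)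
      thus ?thesis by (simp add: ip_def algebra_simps sum_subtractf sum_distrib_left)
    qed
    define \<beta> where "\<beta> = \<bar>\<nu>\<bar> + (\<Sum>i<n. \<Sum>j<n. \<bar>a i j\<bar>)"
    have \<beta>: "0 \<le> \<beta>" by (simp add: \<beta>_def sum_nonneg)
    \<comment> \<open>For mean-zero \<open>x\<close>, \<open>K\<close> bounds the square norm of
      \<open>x\<close> by that of \<open>m x\<close>, and \<beta> bounds the latter by the form of
      \<open>m = \<nu> - a\<close>. The form is thus at least \<open>1 / (K * \<beta> + 1)\<close>
      times the square norm; the added 1 keeps the denominator positive.\<close>
    have "ip n x (mv n a x) \<le> (\<nu> - 1 / (K * \<beta> + 1)) * ip n x x" if x: "(\<Sum>i<n. x i) = 0" for x
    proof -
      have "ip n (mv n m x) (mv n m x) \<le> \<beta> * ip n x (mv n m x)"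
      proof (rule psd_norm_image_le[OF _ _ _ x])
        show "m i j = m j i" if "i < n" "j < n" for i j
          using sym[OF that] by (simp add: m_def)
        show "0 \<le> ip n z (mv n m z)" if "(\<Sum>i<n. z i) = 0" for z
          using \<nu>[OF that] by (simp add: ip_m)
        show "ip n z (mv n m z) \<le> \<beta> * ip n z z" for z
          using ip_mv_abs_le[of n z a] mult_right_mono[OF abs_ge_self[of \<nu>] ip_self_nonneg[of n z]]
          by (simp add: ip_m \<beta>_def distrib_right)
        show "(\<Sum>i<n. mv n m x i) = 0" using x by (simp add: sum_m)
      qed
      hence "K * ip n (mv n m x) (mv n m x) \<le> K * (\<beta> * ip n x (mv n m x))"
        using K(1) by simp
      with K(2)[of x] x have "ip n x x \<le> K * \<beta> * ip n x (mv n m x)"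
        by (simp add: m'_mv[abs_def] eta_contract_eq mult_ac)
      also have "\<dots> \<le> (K * \<beta> + 1) * ip n x (mv n m x)"
        using \<nu>[OF x] by (intro mult_right_mono) (auto simp: ip_m)
      finally have "ip n x x / (K * \<beta> + 1) \<le> ip n x (mv n m x)"
        using K(1) \<beta> by (simp add: divide_simps add_nonneg_pos mult.commute)
      thus ?thesis by (simp add: ip_m algebra_simps)
    qed
    from min[OF this] have "1 / (K * \<beta> + 1) \<le> 0" by simp
    moreover have "K * \<beta> + 1 > 0" using K(1) \<beta> by (simp add: add_nonneg_pos)
    ultimately show False by (simp add: divide_simps)
  qed
  then obtain y where y: "\<And>i. i < n \<Longrightarrow> mv n m' y i = 0" "\<exists>i<n. y i \<noteq> 0" by blast
  have "0 = (\<Sum>i<n. mv n m' y i)" using y by simp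
  also have "\<dots> = (\<nu> - d) * (\<Sum>i<n. y i) + real n * (\<gamma> * (\<Sum>i<n. y i))"
    by (simp add: m'_mv sum.distrib sum_m)
  also have "\<dots> = (\<Sum>i<n. y i)"
    using n by (simp add: \<gamma>_def field_simps)
  finally have s: "(\<Sum>i<n. y i) = 0" by simp
  show thesis
  proof (rule that[OF s y(2)])
    show "mv n a y i = \<nu> * y i" if "i < n" for i
      using y(1)[OF that] that s by (simp add: m'_mv m_mv)
  qed (use \<nu> in auto)
qed

section \<open>The second eigenvalue\<close>

text \<open>If the second entry were below \<open>min a b\<close>, then by sortedness at most the
  head could reach \<open>min a b\<close>, yet both \<open>a\<close> and \<open>b\<close> do.
  Multiset inclusion covers \<open>a = b\<close>.\<close>

lemma sorted_desc_nth_1_ge: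
  fixes xs :: "real list"
  assumes sorted: "sorted_wrt (\<ge>) xs" and sub: "{#a, b#} \<subseteq># mset xs"
  shows "min a b \<le> xs ! 1"
proof (rule ccontr)
  assume less: "\<not> min a b \<le> xs ! 1"
  have len: "2 \<le> length (filter ((\<le>) (min a b)) xs)"
  proof -
    have "{#a, b#} \<subseteq># filter_mset ((\<le>) (min a b)) (mset xs)"
      using multiset_filter_mono[OF sub, of "(\<le>) (min a b)"] by simp
    from size_mset_mono[OF this] show ?thesis
      by (metis mset_filter size_mset size_add_mset size_single numeral_2_eq_2 One_nat_def)
  qed
  then obtain x y zs where xs: "xs = x # y # zs"
    by (cases xs; cases "tl xs") (auto split: if_splits)
  have "filter ((\<le>) (min a b)) zs = []"
    using sorted less by (force simp: xs filter_empty_conv)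
  with len less show False by (simp add: xs split: if_splits)
qed

text \<open>Divisibility by the product, rather than by each factor, makes a double root count
  twice.\<close>

lemma nth_eigenvalue_2_ge:
  assumes A: "A \<in> carrier_mat n n" and dvd: "[:- a, 1:] * [:- b, 1:] dvd char_poly A"
  shows "min a b \<le> nth_eigenvalue A 2"
proof -
  obtain q where q: "char_poly A = [:- a, 1:] * [:- b, 1:] * q" using dvd by blast
  have "char_poly A \<noteq> 0"
    using degree_monic_char_poly[OF A] by auto
  hence nz: "[:- a, 1:] * [:- b, 1:] \<noteq> 0" "q \<noteq> 0" "[:- a, 1:] \<noteq> 0" "[:- b, 1:] \<noteq> 0"
    unfolding q by auto
  have "proots (char_poly A) = {#a, b#} + proots q"
    unfolding q by (subst proots_mult; (subst proots_mult)?) (use nz in auto)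
  hence "{#a, b#} \<subseteq># mset (eigenvalues_desc A)"
    by (simp add: eigenvalues_desc_def)
  moreover have "sorted_wrt (\<ge>) (eigenvalues_desc A)"
    using sorted_sorted_list_of_multiset[of "proots (char_poly A)"]
    by (simp add: eigenvalues_desc_def sorted_wrt_rev)
  ultimately show ?thesis
    unfolding nth_eigenvalue_def by (simp add: sorted_desc_nth_1_ge[of "eigenvalues_desc A" a b, simplified])
qed

lemma index_mult_mat_sum:
  "A \<in> carrier_mat n m \<Longrightarrow> B \<in> carrier_mat m k \<Longrightarrow> i < n \<Longrightarrow> j < k \<Longrightarrow>
    (A * B) $$ (i, j) = (\<Sum>l<m. A $$ (i, l) * B $$ (l, j))"
  by (simp add: scalar_prod_def lessThan_atLeast0)

text \<open>Conjugation with the basis obtained from the standard one by replacing its first member by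
  the all-ones vector makes the matrix block triangular, and the remaining eigenvector survives in
  the lower right block. So the multiplicities are right even if \<open>\<nu> = d\<close>.\<close>
lemma char_poly_dvd_constant_row_sums:
  fixes a :: "nat \<Rightarrow> nat \<Rightarrow> real"
  assumes rows: "\<And>i. i < n \<Longrightarrow> (\<Sum>j<n. a i j) = d"
    and y: "(\<Sum>i<n. y i) = 0" "\<exists>i<n. y i \<noteq> 0"
    and ev: "\<And>i. i < n \<Longrightarrow> mv n a y i = \<nu> * y i"
  shows "[:- d, 1:] * [:- \<nu>, 1:] dvd char_poly (Matrix.mat n n (\<lambda>(i, j). a i j))"
proof -
  obtain m where n: "n = Suc m" using y(2) by (cases n) auto
  define A where "A = Matrix.mat n n (\<lambda>(i, j). a i j)"
  define P where "P = Matrix.mat n n (\<lambda>(i, j). if j = 0 \<or> i = j then 1 else (0::real))"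
  define Q where "Q = Matrix.mat n n
    (\<lambda>(i, j). if i = j then 1 else if j = 0 then - 1 else (0::real))"
  define A1 where "A1 = Matrix.mat 1 1 (\<lambda>_. d)"
  define A2 where "A2 = Matrix.mat 1 m (\<lambda>(_, j). a 0 (Suc j))"
  \<comment> \<open>In the basis consisting of the all-ones vector and \<open>e_1, ..., e_m\<close>,
    column \<open>j\<close> of \<open>a\<close> has first coordinate \<open>a 0 j\<close>, which is
    subtracted from all the other entries.\<close>
  define A3 where "A3 = Matrix.mat m m (\<lambda>(i, j). a (Suc i) (Suc j) - a 0 (Suc j))"
  define B where "B = four_block_mat A1 A2 (0\<^sub>m m 1) A3"
  have A: "A \<in> carrier_mat n n" and P: "P \<in> carrier_mat n n" and Q: "Q \<in> carrier_mat n n"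
    and A1: "A1 \<in> carrier_mat 1 1" and A2: "A2 \<in> carrier_mat 1 m" and A3: "A3 \<in> carrier_mat m m"
    by (simp_all add: A_def P_def Q_def A1_def A2_def A3_def)
  have B: "B \<in> carrier_mat n n"
    using four_block_carrier_mat[OF A1 A3, of A2 "0\<^sub>m m 1"] by (simp add: B_def n)
  have B_index: "B $$ (i, j) = (if j = 0 then if i = 0 then d else 0
      else if i = 0 then a 0 j else a i j - a 0 j)" if "i < n" "j < n" for i j
    using that by (auto simp: B_def n A1_def A2_def A3_def)
  have P_sum: "(\<Sum>k<n. P $$ (i, k) * f k) = (if i = 0 then f 0 else f 0 + f i)"
    if "i < n" for i and f :: "nat \<Rightarrow> real"
  proof -
    have "(\<Sum>k<n. P $$ (i, k) * f k)
        = (\<Sum>k<n. (if k = 0 then f k else 0) + (if k = i then if i = 0 then 0 else f k else 0))"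
      using that by (intro sum.cong) (auto simp: P_def)
    thus ?thesis using that by (simp add: sum.distrib n)
  qed
  have PQ: "P * Q = 1\<^sub>m n"
  proof (rule eq_matI)
    fix i j assume "i < dim_row (1\<^sub>m n)" "j < dim_col (1\<^sub>m n)"
    hence ij: "i < n" "j < n" by auto
    show "(P * Q) $$ (i, j) = 1\<^sub>m n $$ (i, j)"
      unfolding index_mult_mat_sum[OF P Q ij] P_sum[OF ij(1)] using ij by (auto simp: Q_def)
  qed (use P Q in auto)
  hence QP: "Q * P = 1\<^sub>m n" by (rule mat_mult_left_right_inverse[OF P Q])
  have "P * B = A * P"
  proof (rule eq_matI)
    fix i j assume "i < dim_row (A * P)" "j < dim_col (A * P)"
    hence ij: "i < n" "j < n" using A P by auto
    have "(A * P) $$ (i, j) = (\<Sum>k<n. a i k * P $$ (k, j))"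
      unfolding index_mult_mat_sum[OF A P ij] using ij by (simp add: A_def)
    also have "\<dots> = (if j = 0 then d else a i j)"
    proof (cases "j = 0")
      case True
      thus ?thesis using rows[OF ij(1)] ij by (simp add: P_def)
    next
      case False
      have "(\<Sum>k<n. a i k * P $$ (k, j)) = (\<Sum>k<n. if k = j then a i k else 0)"
        using ij False by (intro sum.cong) (auto simp: P_def)
      thus ?thesis using False ij by simp
    qed
    finally show "(P * B) $$ (i, j) = (A * P) $$ (i, j)"
      unfolding index_mult_mat_sum[OF P B ij] P_sum[OF ij(1)] using ij by (simp add: B_index)
  qed (use A B P in auto)
  hence "P * B * Q = A * (P * Q)" using A P Q by (simp add: assoc_mult_mat[OF A P Q])
  hence "A = P * B * Q" using PQ A by simp
  with A B P Q PQ QP have "similar_mat A B" by (intro similar_matI[of _ _ P Q n]) auto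
  hence cp: "char_poly A = char_poly A1 * char_poly A3"
    using char_poly_four_block_zeros_col[OF A1 A2 A3] by (simp add: char_poly_similar B_def)
  have "char_poly A1 = [:- d, 1:]"
    by (subst char_poly_upper_triangular[OF A1]) (auto simp: A1_def diag_mat_def upper_triangular_def)
  moreover have "[:- \<nu>, 1:] dvd char_poly A3"
  proof -
    \<comment> \<open>These are the coordinates of \<open>y\<close> in the new basis, without the
      first. They vanish only if \<open>y\<close> is constant, which is excluded for a nonzero
      mean-zero vector.\<close>
    define v where "v = Matrix.vec m (\<lambda>i. y (Suc i) - y 0)"
    have v: "v \<in> carrier_vec m" by (simp add: v_def)
    have "v \<noteq> 0\<^sub>v m"
    proof
      assume 0: "v = 0\<^sub>v m"
      have const: "y i = y 0" if "i < n" for i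
      proof (cases i)
        case (Suc k)
        hence "v $ k = 0" using that 0 by (simp add: n)
        thus ?thesis using that Suc by (simp add: v_def n)
      qed simp
      have "(\<Sum>i<n. y i) = (\<Sum>i<n. y 0)" by (intro sum.cong refl const) simp
      hence "y 0 = 0" using y(1) by (simp add: n)
      with const y(2) show False by metis
    qed
    moreover have "A3 *\<^sub>v v = \<nu> \<cdot>\<^sub>v v"
    proof (rule eq_vecI)
      fix i assume "i < dim_vec (\<nu> \<cdot>\<^sub>v v)"
      hence i: "i < m" by (simp add: v_def)
      have "(A3 *\<^sub>v v) $ i = (\<Sum>j<m. (a (Suc i) (Suc j) - a 0 (Suc j)) * (y (Suc j) - y 0))"
        using i mult_mat_vec_index[OF A3 v i] by (simp add: A3_def v_def)
      \<comment> \<open>The added term with \<open>j = 0\<close> is zero. Over the full range, the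
        part multiplied by \<open>y 0\<close> cancels because all row sums agree.\<close>
      also have "\<dots> = (\<Sum>j<n. (a (Suc i) j - a 0 j) * (y j - y 0))"
        unfolding n by (subst sum.lessThan_Suc_shift) simp
      also have "\<dots> = mv n a y (Suc i) - mv n a y 0
          - ((\<Sum>j<n. a (Suc i) j) - (\<Sum>j<n. a 0 j)) * y 0"
        by (simp add: mv_def algebra_simps sum.distrib sum_subtractf sum_distrib_left)
      also have "\<dots> = \<nu> * (y (Suc i) - y 0)"
        using i rows[of "Suc i"] rows[of 0] ev[of "Suc i"] ev[of 0]
        by (simp add: n right_diff_distrib)
      finally show "(A3 *\<^sub>v v) $ i = (\<nu> \<cdot>\<^sub>v v) $ i" using i by (simp add: v_def)
    qed (simp add: v_def A3_def)
    ultimately have "eigenvalue A3 \<nu>"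
      using v A3 unfolding eigenvalue_def eigenvector_def by auto
    thus ?thesis using eigenvalue_root_char_poly[OF A3] by (simp add: poly_eq_0_iff_dvd)
  qed
  ultimately show ?thesis unfolding A_def[symmetric] cp by (metis mult_dvd_mono dvd_refl)
qed

text \<open>The best Rayleigh constant \<nu> and \<open>d\<close> together occupy two places in the
  list of roots, so the second entry is at least \<open>min d \<nu>\<close>. As it is smaller than
  \<open>d\<close>, this minimum can only be \<nu>.\<close>

lemma Rayleigh_le_second_eigenvalue:
  fixes a :: "nat \<Rightarrow> nat \<Rightarrow> real" and n :: nat
  defines "A \<equiv> Matrix.mat n n (\<lambda>(i, j). a i j)"
  assumes n: "2 \<le> n"
    and sym: "\<And>i j. i < n \<Longrightarrow> j < n \<Longrightarrow> a i j = a j i"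
    and rows: "\<And>i. i < n \<Longrightarrow> (\<Sum>j<n. a i j) = d"
    and gap: "nth_eigenvalue A 2 < d"
    and x: "(\<Sum>i<n. x i) = 0"
  shows "ip n x (mv n a x) \<le> nth_eigenvalue A 2 * ip n x x"
proof -
  obtain \<nu> y where y: "(\<Sum>i<n. y i) = 0" "\<exists>i<n. y i \<noteq> 0"
      "\<And>i. i < n \<Longrightarrow> mv n a y i = \<nu> * y i"
    and \<nu>: "\<And>x. (\<Sum>i<n. x i) = 0 \<Longrightarrow> ip n x (mv n a x) \<le> \<nu> * ip n x x"
    by (rule Rayleigh_eigenvector[of n a d]) (use n sym rows in blast)+
  have "min d \<nu> \<le> nth_eigenvalue A 2"
    unfolding A_def using char_poly_dvd_constant_row_sums[of n a d y \<nu>] rows y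
    by (intro nth_eigenvalue_2_ge[of _ n]) auto
  with gap have "\<nu> * ip n x x \<le> nth_eigenvalue A 2 * ip n x x"
    by (intro mult_right_mono ip_self_nonneg) auto
  with \<nu>[OF x] show ?thesis by simp
qed

section \<open>Regular graphs with a spectral gap\<close>

lemma add_eq_imp_eq_diff_mat:
  fixes A :: "real mat"
  assumes "A \<in> carrier_mat n m" "B \<in> carrier_mat n m" "A + B = C"
  shows "A = C - B"
  unfolding assms(3)[symmetric] using assms(1,2) by (intro eq_matI) auto

lemma minus_zero_mat_right:
  fixes A :: "real mat"
  shows "A \<in> carrier_mat n m \<Longrightarrow> A - 0\<^sub>m n m = A"
  by (intro eq_matI) auto

text \<open>Penrose's argument: transposing \<open>A X = (A Y) (A X)\<close> gives
  \<open>A X = (A X) (A Y) = A Y\<close>, and similarly \<open>X A = Y A\<close>; hence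
  \<open>X = X A X = X A Y = Y A Y = Y\<close>.\<close>

lemma is_pseudo_inverse_unique:
  assumes A: "A \<in> carrier_mat n n" and X: "is_pseudo_inverse A X" and Y: "is_pseudo_inverse A Y"
  shows "X = Y"
proof -
  have cX: "X \<in> carrier_mat n n" and cY: "Y \<in> carrier_mat n n"
    using A X Y by (auto simp: is_pseudo_inverse_def)
  have sX: "transpose_mat (A * X) = A * X" "transpose_mat (X * A) = X * A"
    "A * X * A = A" "X * A * X = X" using X by (auto simp: is_pseudo_inverse_def)
  have sY: "transpose_mat (A * Y) = A * Y" "transpose_mat (Y * A) = Y * A"
    "A * Y * A = A" "Y * A * Y = Y" using Y by (auto simp: is_pseudo_inverse_def)
  have "A * X = A * Y * (A * X)"
    using assoc_mult_mat[of "A * Y" n n A n X n] sY(3) A cX cY by simp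
  hence "A * X = transpose_mat (A * Y * (A * X))"
    using sX(1) by metis
  also have "\<dots> = A * X * (A * Y)"
    using transpose_mult[of "A * Y" n n "A * X" n] sX(1) sY(1) A cX cY by simp
  also have "\<dots> = A * Y"
    using assoc_mult_mat[of "A * X" n n A n Y n] sX(3) A cX cY by simp
  finally have 1: "A * X = A * Y" .
  have "X * A = X * A * (Y * A)"
    using assoc_mult_mat[of X n n A n "Y * A" n] assoc_mult_mat[of A n n Y n A n] sY(3) A cX cY
    by simp
  hence "X * A = transpose_mat (X * A * (Y * A))"
    using sX(2) by metis
  also have "\<dots> = Y * A * (X * A)"
    using transpose_mult[of "X * A" n n "Y * A" n] sX(2) sY(2) A cX cY by simp
  also have "\<dots> = Y * A"
    using assoc_mult_mat[of Y n n A n "X * A" n] assoc_mult_mat[of A n n X n A n] sX(3) A cX cY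
    by simp
  finally have 2: "X * A = Y * A" .
  have "X = X * (A * X)" using assoc_mult_mat[OF cX A cX] sX(4) by simp
  also have "\<dots> = X * A * Y" using assoc_mult_mat[OF cX A cY] 1 by simp
  also have "\<dots> = Y" using 2 sY(4) by simp
  finally show ?thesis .
qed

locale gapped_regular_graph =
  fixes n d :: nat and E :: "nat set set"
  assumes n2: "2 \<le> n" and regular: "regular_graph n d E"
    and gap: "nth_eigenvalue (adjacency_matrix n E) 2 < real d"
begin

definition \<mu>\<^sub>2 :: real where "\<mu>\<^sub>2 = real d - nth_eigenvalue (adjacency_matrix n E) 2"

definition adj_fun :: "nat \<Rightarrow> nat \<Rightarrow> real" where
  "adj_fun i j = (if {i, j} \<in> E then 1 else 0)"

definition lap :: "(nat \<Rightarrow> real) \<Rightarrow> nat \<Rightarrow> real" where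
  "lap x i = real d * x i - mv n adj_fun x i"

definition lazy_mat :: "nat \<Rightarrow> nat \<Rightarrow> real" where
  "lazy_mat i j = (if i = j then 1 / 2 else 0) + adj_fun i j / (2 * real d)"

abbreviation lazy :: "(nat \<Rightarrow> real) \<Rightarrow> nat \<Rightarrow> real" where
  "lazy \<equiv> mv n lazy_mat"

lemma mu_pos: "0 < \<mu>\<^sub>2"
  using gap by (simp add: \<mu>\<^sub>2_def)

lemma edge_less: "{i, j} \<in> E \<Longrightarrow> i < n \<and> j < n"
  using regular unfolding regular_graph_def simple_graph_def by (auto simp: doubleton_eq_iff)

lemma neighbours_subset: "neighbours E i \<subseteq> {..<n}"
  using edge_less by (auto simp: neighbours_def)

lemma card_neighbours: "i < n \<Longrightarrow> card (neighbours E i) = d"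
  using regular by (simp add: regular_graph_def)

lemma adj_fun_sym: "adj_fun i j = adj_fun j i"
  by (simp add: adj_fun_def insert_commute)

lemma mv_adj_fun: "mv n adj_fun x i = (\<Sum>j\<in>neighbours E i. x j)"
proof -
  have "mv n adj_fun x i = (\<Sum>j<n. if j \<in> neighbours E i then x j else 0)"
    unfolding mv_def adj_fun_def neighbours_def by (intro sum.cong) auto
  also have "\<dots> = (\<Sum>j\<in>{..<n} \<inter> neighbours E i. x j)"
    by (simp add: sum.inter_restrict)
  finally show ?thesis using neighbours_subset by (simp add: Int_absorb1)
qed

lemma adj_fun_rows: "i < n \<Longrightarrow> (\<Sum>j<n. adj_fun i j) = real d"
  using mv_adj_fun[of "\<lambda>_. 1" i] card_neighbours by (simp add: mv_def)

lemma lap_eq_sum: "i < n \<Longrightarrow> lap x i = (\<Sum>j\<in>neighbours E i. x i - x j)"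
  by (simp add: lap_def mv_adj_fun sum_subtractf card_neighbours)

lemma ip_adj_le:
  assumes "(\<Sum>i<n. x i) = 0"
  shows "ip n x (mv n adj_fun x) \<le> (real d - \<mu>\<^sub>2) * ip n x x"
proof -
  have "adjacency_matrix n E = Matrix.mat n n (\<lambda>(i, j). adj_fun i j)"
    by (simp add: adjacency_matrix_def adj_fun_def)
  with Rayleigh_le_second_eigenvalue[of n adj_fun "real d" x] n2 adj_fun_sym adj_fun_rows gap assms
  show ?thesis by (simp add: \<mu>\<^sub>2_def)
qed

text \<open>The sum of \<open>(x i + x j)\<^sup>2\<close> over ordered adjacent pairs is
  nonnegative. This is the signless counterpart of the Laplacian form, and it makes the lazy walk
  positive semidefinite.\<close>

lemma ip_adj_ge: "- real d * ip n x x \<le> ip n x (mv n adj_fun x)"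
proof -
  have diag: "(\<Sum>i<n. \<Sum>j<n. adj_fun i j * (x i * x i)) = real d * ip n x x"
    using adj_fun_rows by (simp add: ip_def sum_distrib_left flip: sum_distrib_right)
  have "0 \<le> (\<Sum>i<n. \<Sum>j<n. adj_fun i j * (x i + x j)\<^sup>2)"
    by (intro sum_nonneg) (auto simp: adj_fun_def)
  also have "\<dots> = (\<Sum>i<n. \<Sum>j<n. adj_fun i j * (x i * x i))
      + (\<Sum>i<n. \<Sum>j<n. adj_fun i j * (x j * x j)) + 2 * ip n x (mv n adj_fun x)"
    by (simp add: ip_def mv_def power2_eq_square algebra_simps sum.distrib sum_distrib_left)
  also have "(\<Sum>i<n. \<Sum>j<n. adj_fun i j * (x j * x j)) = (\<Sum>i<n. \<Sum>j<n. adj_fun i j * (x i * x i))"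
    by (subst sum.swap) (simp add: adj_fun_sym)
  finally show ?thesis unfolding diag by simp
qed

text \<open>This yields \<open>d > 0\<close>, the nonnegativity of \<rho>, and
  \<open>d / \<mu>\<^sub>2 \<ge> 1 / 2\<close>, which keeps the walk length away from 0.\<close>

lemma mu_le: "\<mu>\<^sub>2 \<le> 2 * real d"
proof -
  obtain e where e: "(\<Sum>i<n. e i) = 0" "ip n e e = 2"
    using mean_zero_vector_exists[OF n2] by blast
  show ?thesis using ip_adj_le[OF e(1)] ip_adj_ge[of e] e(2) by simp
qed

lemma d_pos: "0 < d"
  using mu_le mu_pos by (cases d) auto

lemma Poincare:
  assumes "(\<Sum>i<n. x i) = 0"
  shows "\<mu>\<^sub>2 * ip n x x \<le> ip n x (lap x)"
proof -
  have "ip n x (lap x) = real d * ip n x x - ip n x (mv n adj_fun x)"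
    by (simp add: ip_def lap_def algebra_simps sum_subtractf sum_distrib_left)
  with ip_adj_le[OF assms] show ?thesis by (simp add: algebra_simps)
qed

text \<open>Cauchy-Schwarz turns the bound on the form into one on norms, stated with squares to
  avoid roots.\<close>

lemma norm_le_norm_lap:
  assumes "(\<Sum>i<n. x i) = 0"
  shows "\<mu>\<^sub>2\<^sup>2 * ip n x x \<le> ip n (lap x) (lap x)"
proof (cases "ip n x x = 0")
  case True
  thus ?thesis using ip_self_nonneg by simp
next
  case False
  with ip_self_nonneg[of n x] have pos: "ip n x x > 0" by simp
  have "(\<mu>\<^sub>2 * ip n x x)\<^sup>2 \<le> (ip n x (lap x))\<^sup>2"
    using Poincare[OF assms] mu_pos pos by (intro power_mono) auto
  also have "\<dots> \<le> ip n x x * ip n (lap x) (lap x)"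
    using Cauchy_Schwarz_ineq_sum[of x "lap x" "{..<n}"] by (simp add: ip_def power2_eq_square)
  finally show ?thesis using pos by (simp add: power2_eq_square mult_ac)
qed

lemma lap_eq_0_imp:
  assumes "(\<Sum>i<n. x i) = 0" and "\<And>i. i < n \<Longrightarrow> lap x i = 0" and "i < n"
  shows "x i = 0"
proof -
  have "ip n (lap x) (lap x) = 0" using assms(2) by (simp add: ip_def)
  with norm_le_norm_lap[OF assms(1)] mu_pos ip_self_nonneg[of n x] have "ip n x x = 0"
    by (simp add: mult_le_0_iff)
  with assms(3) show ?thesis by (simp add: ip_self_eq_0_iff)
qed

section \<open>The lazy walk and its contraction of mean-zero vectors\<close>

lemma lazy_eq: "i < n \<Longrightarrow> lazy x i = (x i + mv n adj_fun x i / real d) / 2"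
proof -
  assume i: "i < n"
  have "lazy x i = (\<Sum>j<n. if i = j then x j / 2 else 0) + (\<Sum>j<n. adj_fun i j * x j / (2 * real d))"
    unfolding mv_def lazy_mat_def sum.distrib[symmetric]
    by (intro sum.cong) (auto simp: algebra_simps)
  also have "\<dots> = x i / 2 + mv n adj_fun x i / (2 * real d)"
    using i by (simp add: mv_def sum_divide_distrib)
  finally show ?thesis by (simp add: add_divide_distrib)
qed

lemma lap_eq_lazy: "i < n \<Longrightarrow> lap x i = 2 * real d * (x i - lazy x i)"
  using d_pos by (simp add: lazy_eq lap_def field_simps)

lemma lazy_mat_sym: "lazy_mat i j = lazy_mat j i"
  by (simp add: lazy_mat_def adj_fun_sym)

lemma sum_lazy: "(\<Sum>i<n. lazy x i) = (\<Sum>i<n. x i)"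
proof -
  have "(\<Sum>j<n. lazy_mat i j) = 1" if "i < n" for i
    using lazy_eq[OF that, of "\<lambda>_. 1"] adj_fun_rows[OF that] d_pos by (simp add: mv_def)
  thus ?thesis using sum_mv[of n lazy_mat 1 x] lazy_mat_sym by simp
qed

lemma ip_lazy: "ip n x (lazy x) = (ip n x x + ip n x (mv n adj_fun x) / real d) / 2"
proof -
  have "ip n x (lazy x) = ip n x (\<lambda>i. (x i + mv n adj_fun x i / real d) / 2)"
    by (intro ip_cong) (auto simp: lazy_eq)
  thus ?thesis
    by (simp add: ip_def algebra_simps sum.distrib sum_divide_distrib add_divide_distrib)
qed

definition \<rho> :: real where "\<rho> = 1 - \<mu>\<^sub>2 / (2 * real d)"

lemma rho_nonneg: "0 \<le> \<rho>"
  using mu_le d_pos by (simp add: \<rho>_def)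

text \<open>The two factors \<rho> have different origins: one from bounding the norm of the image
  by the form, the other from bounding the form by the norm.\<close>

lemma lazy_contraction:
  assumes x: "(\<Sum>i<n. x i) = 0"
  shows "ip n (lazy x) (lazy x) \<le> \<rho>\<^sup>2 * ip n x x"
proof -
  have upper: "ip n z (lazy z) \<le> \<rho> * ip n z z" if "(\<Sum>i<n. z i) = 0" for z
  proof -
    have "ip n z (lazy z) \<le> (ip n z z + (real d - \<mu>\<^sub>2) * ip n z z / real d) / 2"
      unfolding ip_lazy using ip_adj_le[OF that] by (intro divide_right_mono add_left_mono) auto
    also have "\<dots> = \<rho> * ip n z z"
      using d_pos by (simp add: \<rho>_def field_simps)
    finally show ?thesis .
  qed
  have "ip n (lazy x) (lazy x) \<le> \<rho> * ip n x (lazy x)"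
  proof (rule psd_norm_image_le[OF _ _ _ x])
    show "lazy_mat i j = lazy_mat j i" for i j by (rule lazy_mat_sym)
    show "0 \<le> ip n z (lazy z)" for z
      using ip_adj_ge[of z] d_pos by (simp add: ip_lazy field_simps)
    show "(\<Sum>i<n. lazy x i) = 0" using x by (simp add: sum_lazy)
  qed (use upper in auto)
  also have "\<dots> \<le> \<rho> * (\<rho> * ip n x x)"
    by (intro mult_left_mono upper x rho_nonneg)
  finally show ?thesis by (simp add: power2_eq_square mult_ac)
qed

lemma lazy_power_contraction:
  assumes x: "(\<Sum>i<n. x i) = 0"
  shows "(\<Sum>i<n. (lazy ^^ t) x i) = 0"
    and "ip n ((lazy ^^ t) x) ((lazy ^^ t) x) \<le> (\<rho> ^ t)\<^sup>2 * ip n x x"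
proof (induction t)
  case (Suc t)
  case 1
  show ?case using Suc(1) by (simp add: sum_lazy)
next
  case (Suc t)
  case 2
  have "ip n ((lazy ^^ Suc t) x) ((lazy ^^ Suc t) x) \<le> \<rho>\<^sup>2 * ip n ((lazy ^^ t) x) ((lazy ^^ t) x)"
    using lazy_contraction[OF Suc(1)] by simp
  also have "\<dots> \<le> \<rho>\<^sup>2 * ((\<rho> ^ t)\<^sup>2 * ip n x x)"
    by (intro mult_left_mono Suc(2)) auto
  finally show ?case by (simp add: power_mult_distrib mult_ac)
qed (use x in auto)

lemma abs_lap_le:
  assumes "i < n" and "\<And>i j. {i, j} \<in> E \<Longrightarrow> \<bar>x i - x j\<bar> \<le> M"
  shows "\<bar>lap x i\<bar> \<le> real d * M"
proof -
  have "\<bar>lap x i\<bar> \<le> (\<Sum>j\<in>neighbours E i. \<bar>x i - x j\<bar>)"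
    unfolding lap_eq_sum[OF assms(1)] by (rule sum_abs)
  also have "\<dots> \<le> (\<Sum>j\<in>neighbours E i. M)"
    using assms(2) by (intro sum_mono) (auto simp: neighbours_def)
  finally show ?thesis using assms(1) by (simp add: card_neighbours)
qed

text \<open>Sparsity enters here: at most \<open>m\<close> coordinates of \<open>lap x\<close> are
  nonzero, and each is at most \<open>d M\<close>, so the norm of \<open>x\<close> does not involve
  \<open>n\<close>.\<close>

lemma lazy_power_le:
  assumes x: "(\<Sum>i<n. x i) = 0" and M: "\<And>i j. {i, j} \<in> E \<Longrightarrow> \<bar>x i - x j\<bar> \<le> M" "0 \<le> M"
    and m: "card {i. i < n \<and> lap x i \<noteq> 0} = m" and u: "u < n"
  shows "\<bar>(lazy ^^ t) x u\<bar> \<le> \<rho> ^ t * (real m * (real d / \<mu>\<^sub>2) * M)"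
proof -
  have "ip n (lap x) (lap x) = (\<Sum>i | i < n \<and> lap x i \<noteq> 0. (lap x i)\<^sup>2)"
    unfolding ip_def power2_eq_square by (rule sum.mono_neutral_right) auto
  also have "\<dots> \<le> (\<Sum>i | i < n \<and> lap x i \<noteq> 0. (real d * M)\<^sup>2)"
    using abs_lap_le M by (intro sum_mono) (auto simp: abs_le_square_iff[symmetric])
  also have "\<dots> = real m * (real d * M)\<^sup>2" using m by simp
  \<comment> \<open>A cruder bound, with \<open>m\<close> for the root of \<open>m\<close>, matches
    the \<open>m\<close> inside the logarithm of \<open>s\<close>.\<close>
  also have "\<dots> \<le> (real m)\<^sup>2 * (real d * M)\<^sup>2"
    by (intro mult_right_mono) (cases m, auto simp: power2_eq_square)
  finally have "\<mu>\<^sub>2\<^sup>2 * ip n x x \<le> (real m * real d * M)\<^sup>2"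
    using norm_le_norm_lap[OF x] by (simp add: power_mult_distrib mult_ac)
  hence norm_x: "ip n x x \<le> (real m * (real d / \<mu>\<^sub>2) * M)\<^sup>2"
    using mu_pos by (simp add: field_simps power_mult_distrib)
  have "((lazy ^^ t) x u)\<^sup>2 \<le> ip n ((lazy ^^ t) x) ((lazy ^^ t) x)"
    by (rule component_sq_le_ip[OF u])
  also have "\<dots> \<le> (\<rho> ^ t)\<^sup>2 * ip n x x"
    by (rule lazy_power_contraction[OF x])
  also have "\<dots> \<le> (\<rho> ^ t)\<^sup>2 * (real m * (real d / \<mu>\<^sub>2) * M)\<^sup>2"
    by (intro mult_left_mono norm_x) auto
  finally have "((lazy ^^ t) x u)\<^sup>2 \<le> (\<rho> ^ t * (real m * (real d / \<mu>\<^sub>2) * M))\<^sup>2"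
    by (simp only: power_mult_distrib)
  hence "\<bar>(lazy ^^ t) x u\<bar> \<le> \<bar>\<rho> ^ t * (real m * (real d / \<mu>\<^sub>2) * M)\<bar>"
    by (simp only: abs_le_square_iff)
  moreover have "0 \<le> \<rho> ^ t * (real m * (real d / \<mu>\<^sub>2) * M)"
    using rho_nonneg mu_pos M(2) by simp
  ultimately show ?thesis by linarith
qed

section \<open>The Laplacian matrix and its pseudo-inverse\<close>

lemma laplacian_carrier: "laplacian n d E \<in> carrier_mat n n"
  by (intro carrier_matI) (simp_all add: laplacian_def adjacency_matrix_def)

lemma laplacian_mult_index:
  assumes "x \<in> carrier_vec n" "i < n"
  shows "(laplacian n d E *\<^sub>v x) $ i = lap (($) x) i"
proof -
  have "(laplacian n d E *\<^sub>v x) $ i = (\<Sum>j<n. (if i = j then real d * x $ j else 0) - adj_fun i j * x $ j)"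
    unfolding mult_mat_vec_index[OF laplacian_carrier assms] using assms
    by (intro sum.cong) (auto simp: laplacian_def adjacency_matrix_def adj_fun_def left_diff_distrib)
  thus ?thesis using assms by (simp add: sum_subtractf lap_def mv_def)
qed

lemma sum_lap: "(\<Sum>i<n. lap x i) = 0"
  using sum_mv[of n adj_fun "real d" x] adj_fun_sym adj_fun_rows
  by (simp add: lap_def sum_subtractf flip: sum_distrib_left)

text \<open>The pseudo-inverse is \<open>(L + J)\<^sup>-\<^sup>1 - J\<close>, where \<open>J\<close> is the orthogonal projection onto the
  constant vectors.\<close>
lemma pseudo_inverse_laplacian:
  defines "J \<equiv> Matrix.mat n n (\<lambda>_. 1 / real n)"
  shows "pseudo_inverse (laplacian n d E) \<in> carrier_mat n n"
    and "pseudo_inverse (laplacian n d E) * laplacian n d E = 1\<^sub>m n - J"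
proof -
  define L where "L = laplacian n d E"
  have L: "L \<in> carrier_mat n n" using laplacian_carrier by (simp add: L_def)
  have J: "J \<in> carrier_mat n n" by (simp add: J_def)
  have L_index: "L $$ (i, j) = (if i = j then real d else 0) - adj_fun i j" if "i < n" "j < n" for i j
    using that by (simp add: L_def laplacian_def adjacency_matrix_def adj_fun_def)
  have L_rows: "(\<Sum>j<n. L $$ (i, j)) = 0" if "i < n" for i
    using that adj_fun_rows[OF that] by (simp add: L_index sum_subtractf)
  have L_cols: "(\<Sum>i<n. L $$ (i, j)) = 0" if "j < n" for j
    using that adj_fun_rows[OF that] by (simp add: L_index sum_subtractf adj_fun_sym[of _ j])
  have LJ: "L * J = 0\<^sub>m n n"
  proof (rule eq_matI)
    fix i j assume "i < dim_row (0\<^sub>m n n)" "j < dim_col (0\<^sub>m n n)"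
    hence ij: "i < n" "j < n" by auto
    show "(L * J) $$ (i, j) = 0\<^sub>m n n $$ (i, j)"
      unfolding index_mult_mat_sum[OF L J ij]
      using ij L_rows by (simp add: J_def flip: sum_divide_distrib)
  qed (use L J in auto)
  have JL: "J * L = 0\<^sub>m n n"
  proof (rule eq_matI)
    fix i j assume "i < dim_row (0\<^sub>m n n)" "j < dim_col (0\<^sub>m n n)"
    hence ij: "i < n" "j < n" by auto
    show "(J * L) $$ (i, j) = 0\<^sub>m n n $$ (i, j)"
      unfolding index_mult_mat_sum[OF J L ij]
      using ij L_cols by (simp add: J_def flip: sum_divide_distrib)
  qed (use L J in auto)
  have JJ: "J * J = J"
  proof (rule eq_matI)
    fix i j assume "i < dim_row J" "j < dim_col J"
    hence ij: "i < n" "j < n" using J by auto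
    show "(J * J) $$ (i, j) = J $$ (i, j)"
      unfolding index_mult_mat_sum[OF J J ij] using ij by (simp add: J_def)
  qed (use J in auto)
  define N where "N = L + J"
  have N: "N \<in> carrier_mat n n" using L J by (simp add: N_def)
  obtain Z where Z: "Z \<in> carrier_mat n n" and ZN: "Z * N = 1\<^sub>m n" and NZ: "N * Z = 1\<^sub>m n"
  proof (rule injective_mat_inverse[OF N])
    fix v :: "real Matrix.vec" assume v: "v \<in> carrier_vec n" and 0: "N *\<^sub>v v = 0\<^sub>v n"
    define s where "s = (\<Sum>i<n. v $ i) / real n"
    have Jv: "(J *\<^sub>v v) $ i = s" if "i < n" for i
      unfolding mult_mat_vec_index[OF J v that] using that
      by (simp add: J_def s_def flip: sum_divide_distrib)
    have Nv: "lap (($) v) i + s = 0" if "i < n" for i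
    proof -
      have "(N *\<^sub>v v) $ i = (L *\<^sub>v v) $ i + (J *\<^sub>v v) $ i"
        using L J v that by (simp add: N_def add_mult_distrib_mat_vec[OF L J v])
      thus ?thesis using 0 that v by (simp add: Jv L_def laplacian_mult_index)
    qed
    \<comment> \<open>Summation kills the Laplacian part, so \<open>v\<close> is mean-zero and in
      the kernel of the Laplacian.\<close>
    have "(\<Sum>i<n. lap (($) v) i + s) = 0" using Nv by simp
    hence s: "s = 0" using n2 by (simp add: sum.distrib sum_lap)
    hence "(\<Sum>i<n. v $ i) = 0" using n2 by (simp add: s_def)
    from lap_eq_0_imp[OF this] Nv s have "v $ i = 0" if "i < n" for i using that by simp
    thus "v = 0\<^sub>v n" using v by auto
  qed
  define X where "X = Z - J"
  have X: "X \<in> carrier_mat n n" unfolding X_def using J by (rule minus_carrier_mat)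
  have "J = Z * (N * J)" using assoc_mult_mat[OF Z N J] ZN J by simp
  also have "N * J = J" using L J LJ JJ by (simp add: N_def add_mult_distrib_mat[OF L J J])
  finally have ZJ: "Z * J = J" by simp
  have "J = (J * N) * Z" using assoc_mult_mat[OF J N Z] NZ J by simp
  also have "J * N = J" using L J JL JJ by (simp add: N_def mult_add_distrib_mat[OF J L J])
  finally have JZ: "J * Z = J" by simp
  have LX: "L * X = 1\<^sub>m n - J"
  proof -
    have "L * X = L * Z" 
      using LJ mult_carrier_mat[OF L Z]
      by (simp add: X_def mult_minus_distrib_mat[OF L Z J] minus_zero_mat_right)
    moreover have "L * Z + J = 1\<^sub>m n"
      using NZ JZ by (simp add: N_def add_mult_distrib_mat[OF L J Z])
    ultimately show ?thesis using add_eq_imp_eq_diff_mat[OF mult_carrier_mat[OF L Z] J] by simp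
  qed
  have XL: "X * L = 1\<^sub>m n - J"
  proof -
    have "X * L = Z * L" 
      using JL mult_carrier_mat[OF Z L]
      by (simp add: X_def minus_mult_distrib_mat[OF Z J L] minus_zero_mat_right)
    moreover have "Z * L + J = 1\<^sub>m n"
      using ZN ZJ by (simp add: N_def mult_add_distrib_mat[OF Z L J])
    ultimately show ?thesis using add_eq_imp_eq_diff_mat[OF mult_carrier_mat[OF Z L] J] by simp
  qed
  have tr: "transpose_mat (1\<^sub>m n - J) = 1\<^sub>m n - J"
    by (rule eq_matI) (auto simp: J_def)
  have "L * X * L = L"
    unfolding LX using L J JL 
    by (simp add: minus_mult_distrib_mat[OF one_carrier_mat J L] minus_zero_mat_right)
  moreover have "X * L * X = X"
  proof -
    have "J * X = 0\<^sub>m n n"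
      using J Z JZ JJ by (simp add: X_def mult_minus_distrib_mat[OF J Z J])
    thus ?thesis
      unfolding XL using X J
      by (simp add: minus_mult_distrib_mat[OF one_carrier_mat J X] minus_zero_mat_right)
  qed
  ultimately have "is_pseudo_inverse L X"
    using L X LX XL tr by (auto simp: is_pseudo_inverse_def)
  hence "pseudo_inverse L = X"
    unfolding pseudo_inverse_def by (intro the_equality is_pseudo_inverse_unique[OF L])
  thus "pseudo_inverse (laplacian n d E) \<in> carrier_mat n n"
    "pseudo_inverse (laplacian n d E) * laplacian n d E = 1\<^sub>m n - J"
    using X XL by (simp_all add: L_def)
qed

text \<open>\<open>L\<^sup>+ b = L\<^sup>+ L x = x - J x\<close> differs from \<open>x\<close> by a
  constant vector, which cancels in a difference of coordinates.\<close>

lemma chi_pseudo_inverse: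
  assumes x: "x \<in> carrier_vec n" and b: "laplacian n d E *\<^sub>v x = b" and uv: "u < n" "v < n"
  shows "chi n u v \<bullet> (pseudo_inverse (laplacian n d E) *\<^sub>v b) = x $ u - x $ v"
proof -
  define J where "J = Matrix.mat n n (\<lambda>_. 1 / real n)"
  have J: "J \<in> carrier_mat n n" by (simp add: J_def)
  define w where "w = pseudo_inverse (laplacian n d E) *\<^sub>v b"
  have "w = (1\<^sub>m n - J) *\<^sub>v x"
    unfolding w_def b[symmetric] J_def
    using assoc_mult_mat_vec[OF pseudo_inverse_laplacian(1) laplacian_carrier x]
      pseudo_inverse_laplacian(2) by simp
  also have "\<dots> = x - J *\<^sub>v x"
    using x J by (simp add: minus_mult_distrib_mat_vec[OF one_carrier_mat J x])
  finally have w: "w = x - J *\<^sub>v x" .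
  have "w \<in> carrier_vec n" using x J by (simp add: w)
  hence "chi n u v \<bullet> w = w $ u - w $ v"
    using uv by (simp add: chi_def minus_scalar_prod_distrib[of _ n] scalar_prod_left_unit)
  also have "\<dots> = x $ u - x $ v"
    using uv x J by (simp add: w J_def scalar_prod_def)
  finally show ?thesis by (simp add: w_def)
qed

end

section \<open>Program fragments and the solver\<close>

text \<open>The fragment \<open>cs\<close> started in \<open>\<sigma>\<close> is finished after exactly \<open>k\<close> steps and within time \<open>T\<close>, and
  \<open>D\<close> is the distribution of the resulting store. The number of steps is fixed so that fragments can
  be composed; programs whose branches differ in length have to be padded.\<close>
definition runs :: "nat list list \<Rightarrow> real Matrix.vec \<Rightarrow> nat \<Rightarrow> nat \<Rightarrow> prog \<Rightarrow> store \<Rightarrow> store pmf \<Rightarrow> bool" where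
  "runs adj b k T cs \<sigma> D \<longleftrightarrow> (\<forall>rest t.
     map_pmf (\<lambda>c. (fst c, fst (snd c))) (run adj b k (cs @ rest, \<sigma>, t)) = map_pmf (Pair rest) D \<and>
     (\<forall>c \<in> set_pmf (run adj b k (cs @ rest, \<sigma>, t)). snd (snd c) \<le> t + T))"

lemma runsI:
  assumes "\<And>rest t. map_pmf (\<lambda>c. (fst c, fst (snd c))) (run adj b k (cs @ rest, \<sigma>, t)) = map_pmf (Pair rest) D"
    and "\<And>rest t c. c \<in> set_pmf (run adj b k (cs @ rest, \<sigma>, t)) \<Longrightarrow> snd (snd c) \<le> t + T"
  shows "runs adj b k T cs \<sigma> D"
  using assms by (simp add: runs_def)

lemma runsD:
  assumes "runs adj b k T cs \<sigma> D"
  shows "map_pmf (\<lambda>c. (fst c, fst (snd c))) (run adj b k (cs @ rest, \<sigma>, t)) = map_pmf (Pair rest) D"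
    and "c \<in> set_pmf (run adj b k (cs @ rest, \<sigma>, t)) \<Longrightarrow> snd (snd c) \<le> t + T"
  using assms by (auto simp: runs_def)

lemma run_add: "run adj b (k + l) c = bind_pmf (run adj b k c) (run adj b l)"
proof (induction k arbitrary: c)
  case (Suc k)
  hence "run adj b (k + l) = (\<lambda>c. bind_pmf (run adj b k c) (run adj b l))" by (intro ext)
  thus ?case by (simp add: bind_assoc_pmf)
qed (simp add: bind_return_pmf)

text \<open>The intermediate distribution is written \<open>map_pmf f A\<close> so that the second
  fragment is indexed by a random outcome, such as an index or a partial sum, rather than by a
  store.\<close>

lemma runs_append:
  assumes 1: "runs adj b k T cs \<sigma> (map_pmf f A)"
    and 2: "\<And>x. x \<in> set_pmf A \<Longrightarrow> runs adj b k' T' cs' (f x) (B x)"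
  shows "runs adj b (k + k') (T + T') (cs @ cs') \<sigma> (bind_pmf A B)"
proof (rule runsI)
  fix rest t
  let ?proj = "\<lambda>c :: config. (fst c, fst (snd c))"
  let ?R = "run adj b k (cs @ (cs' @ rest), \<sigma>, t)"
  \<comment> \<open>The clock is restarted at 0, which is harmless because the projected
    distribution does not depend on it.\<close>
  define h where "h = (\<lambda>(ds, \<tau>). map_pmf ?proj (run adj b k' (ds, \<tau>, 0)))"
  note R = runsD[OF 1, where rest = "cs' @ rest" and t = t]
  have supp: "\<exists>x\<in>set_pmf A. fst c = cs' @ rest \<and> fst (snd c) = f x \<and> snd (snd c) \<le> t + T"
    if "c \<in> set_pmf ?R" for c
  proof -
    have "?proj c \<in> set_pmf (map_pmf ?proj ?R)" using that by auto
    thus ?thesis using R that by auto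
  qed
  have "map_pmf ?proj (run adj b (k + k') ((cs @ cs') @ rest, \<sigma>, t))
      = bind_pmf ?R (\<lambda>c. map_pmf ?proj (run adj b k' c))"
    by (simp add: run_add map_bind_pmf)
  also have "\<dots> = bind_pmf ?R (\<lambda>c. h (?proj c))"
  proof (rule bind_pmf_cong[OF refl])
    fix c assume "c \<in> set_pmf ?R"
    from supp[OF this] obtain x t' where x: "x \<in> set_pmf A" and c: "c = (cs' @ rest, f x, t')"
      by (cases c) auto
    show "map_pmf ?proj (run adj b k' c) = h (?proj c)"
      using runsD(1)[OF 2[OF x], where rest = rest and t = 0]
        runsD(1)[OF 2[OF x], where rest = rest and t = t'] by (simp add: c h_def)
  qed
  also have "\<dots> = bind_pmf (map_pmf ?proj ?R) h"
    by (simp add: bind_map_pmf)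
  also have "\<dots> = bind_pmf A (\<lambda>x. h (cs' @ rest, f x))"
    by (simp add: R bind_map_pmf)
  also have "\<dots> = bind_pmf A (\<lambda>x. map_pmf (Pair rest) (B x))"
    using runsD(1)[OF 2, where rest = rest and t = 0] by (intro bind_pmf_cong) (auto simp: h_def)
  finally show "map_pmf ?proj (run adj b (k + k') ((cs @ cs') @ rest, \<sigma>, t)) = map_pmf (Pair rest) (bind_pmf A B)"
    by (simp add: map_bind_pmf)
  fix c' assume "c' \<in> set_pmf (run adj b (k + k') ((cs @ cs') @ rest, \<sigma>, t))"
  then obtain c where c: "c \<in> set_pmf ?R" "c' \<in> set_pmf (run adj b k' c)"
    by (auto simp: run_add)
  from supp[OF c(1)] obtain x t' where x: "x \<in> set_pmf A" "c = (cs' @ rest, f x, t')" "t' \<le> t + T"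
    by (cases c) auto
  show "snd (snd c') \<le> t + (T + T')"
    using runsD(2)[OF 2[OF x(1)], where c = c' and rest = rest and t = t'] c(2) x by simp
qed

lemma runs_append_return:
  "runs adj b k T cs \<sigma> (return_pmf \<tau>) \<Longrightarrow> runs adj b k' T' cs' \<tau> D \<Longrightarrow>
    runs adj b (k + k') (T + T') (cs @ cs') \<sigma> D"
  using runs_append[where f = "\<lambda>_. \<tau>" and A = "return_pmf ()" and B = "\<lambda>_. D"]
  by (simp add: bind_return_pmf)

lemma runs_weaken:
  "runs adj b k T cs \<sigma> D \<Longrightarrow> k = k' \<Longrightarrow> T \<le> T' \<Longrightarrow> runs adj b k' T' cs \<sigma> D"
  unfolding runs_def by (meson add_left_mono order_trans)

lemma runs_Nil: "\<sigma> = \<tau> \<Longrightarrow> runs adj b 0 0 [] \<sigma> (return_pmf \<tau>)"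
  by (simp add: runs_def)

lemma runs_Do: "runs adj b 1 (cost c \<sigma>) [Do c] \<sigma> (exec_instr adj b c \<sigma>)"
proof -
  have "run adj b 0 = return_pmf" by (rule ext) simp
  thus ?thesis by (auto simp: runs_def bind_return_pmf' map_pmf_comp)
qed

lemma runs_Do_det:
  assumes "exec_instr adj b c \<sigma> = return_pmf \<tau>" "cost c \<sigma> = T" "runs adj b k T' cs \<tau> D"
  shows "runs adj b (Suc k) (T + T') (Do c # cs) \<sigma> D"
  using runs_append_return[where cs = "[Do c]" and k = 1 and T = T and \<sigma> = \<sigma> and \<tau> = \<tau>] assms
    runs_weaken[OF runs_Do[of adj b c \<sigma>], of 1 T]
  by simp

lemma runs_Rand:
  assumes "N j = M" "0 < M" and "\<And>r. r < M \<Longrightarrow> runs adj b k T cs (N(i := r), R) (B r)"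
  shows "runs adj b (Suc k) (Suc T) (Do (Rand i j) # cs) (N, R) (bind_pmf (pmf_of_set {..<M}) B)"
proof -
  have "set_pmf (pmf_of_set {..<M}) = {..<M}"
    using assms(2) by (intro set_pmf_of_set) auto
  with runs_append[where cs = "[Do (Rand i j)]" and \<sigma> = "(N, R)" and f = "\<lambda>r. (N(i := r), R)"
      and A = "pmf_of_set {..<M}" and k = 1 and T = 1 and k' = k and T' = T and cs' = cs and B = B
      and adj = adj and b = b] runs_Do[of adj b "Rand i j" "(N, R)"] assms
  show ?thesis by simp
qed

lemma runs_step:
  assumes "\<And>rest t. step adj b (cs @ rest, \<sigma>, t) = return_pmf (cs' @ rest, \<sigma>, Suc t)"
    and "runs adj b k T cs' \<sigma> D"
  shows "runs adj b (Suc k) (Suc T) cs \<sigma> D"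
proof (rule runsI)
  fix rest t
  have *: "run adj b (Suc k) (cs @ rest, \<sigma>, t) = run adj b k (cs' @ rest, \<sigma>, Suc t)"
    by (simp add: assms(1) bind_return_pmf)
  show "map_pmf (\<lambda>c. (fst c, fst (snd c))) (run adj b (Suc k) (cs @ rest, \<sigma>, t)) = map_pmf (Pair rest) D"
    unfolding * by (rule runsD(1)[OF assms(2)])
  show "snd (snd c) \<le> t + Suc T" if "c \<in> set_pmf (run adj b (Suc k) (cs @ rest, \<sigma>, t))" for c
    using runsD(2)[OF assms(2) that[unfolded *]] by simp
qed

lemma runs_If_True:
  "holds p \<sigma> \<Longrightarrow> runs adj b k T (xs @ cs) \<sigma> D \<Longrightarrow> runs adj b (Suc k) (Suc T) (IfElse p xs ys # cs) \<sigma> D"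
  by (erule runs_step[rotated]) auto

lemma runs_If_False:
  "\<not> holds p \<sigma> \<Longrightarrow> runs adj b k T (ys @ cs) \<sigma> D \<Longrightarrow> runs adj b (Suc k) (Suc T) (IfElse p xs ys # cs) \<sigma> D"
  by (erule runs_step[rotated]) auto

lemma runs_While_True:
  "holds p \<sigma> \<Longrightarrow> runs adj b k T (xs @ WhileDo p xs # cs) \<sigma> D \<Longrightarrow>
    runs adj b (Suc k) (Suc T) (WhileDo p xs # cs) \<sigma> D"
  by (erule runs_step[rotated]) auto

lemma runs_While_False:
  "\<not> holds p \<sigma> \<Longrightarrow> runs adj b k T cs \<sigma> D \<Longrightarrow> runs adj b (Suc k) (Suc T) (WhileDo p xs # cs) \<sigma> D"
  by (erule runs_step[rotated]) auto

lemma runs_imp_computes_within: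
  assumes "runs adj b k T P \<sigma> D" and "real T \<le> T'"
  shows "computes_within adj b P \<sigma> T' (map_pmf (\<lambda>\<tau>. snd \<tau> 0) D)"
  unfolding computes_within_def
proof (intro exI conjI)
  let ?R = "run adj b k (P, \<sigma>, 0)"
  note R = runsD[OF assms(1), where rest = "[]" and t = 0, simplified]
  have "fst c = []" if "c \<in> set_pmf ?R" for c
  proof -
    have "(fst c, fst (snd c)) \<in> set_pmf (map_pmf (\<lambda>c. (fst c, fst (snd c))) ?R)" using that by auto
    thus ?thesis unfolding R(1) by auto
  qed
  thus "\<forall>(cs, \<sigma>', t)\<in>set_pmf ?R. cs = [] \<and> real t \<le> T'"
    using R(2) assms(2) by fastforce
  have "map_pmf (\<lambda>(cs, (N, R), t). R 0) ?R
      = map_pmf (\<lambda>(cs, N, R). R 0) (map_pmf (\<lambda>c. (fst c, fst (snd c))) ?R)"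
    unfolding map_pmf_comp by (intro map_pmf_cong refl) auto
  thus "map_pmf (\<lambda>\<tau>. snd \<tau> 0) D = map_pmf (\<lambda>(cs, (N, R), t). R 0) ?R"
    unfolding R(1) by (simp add: map_pmf_comp split_beta)
qed

section \<open>The sampling program\<close>

primrec iid_sum :: "real pmf \<Rightarrow> nat \<Rightarrow> real pmf" where
  "iid_sum W 0 = return_pmf 0"
| "iid_sum W (Suc l) = bind_pmf W (\<lambda>x. map_pmf ((+) x) (iid_sum W l))"

text \<open>\<open>N 5\<close>, \<open>N 6\<close> hold the two positions, \<open>N 3\<close>,
  \<open>N 4\<close> the numbers \<open>d\<close>, \<open>2 d\<close>; \<open>R 7\<close>
  accumulates the sum, \<open>R 9\<close> counts steps, and \<open>R 6\<close> is 1. The assignments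
  to \<open>N 8\<close>, which is always 0, pad the lazy branch; \<open>N 7\<close> and
  \<open>R 10\<close> are cleared so that every step ends in a store of one shape.\<close>

definition walk_step :: prog where
  "walk_step =
    [Do (Entry 10 5), Do (RAdd 7 7 10), Do (Entry 10 6), Do (RSub 7 7 10), Do (Rand 7 4),
     IfElse (NLess 7 3) [Do (Nbr 5 5 7), Do (Nbr 6 6 7)] [Do (NConst 8 0), Do (NConst 8 0)],
     Do (NConst 7 0), Do (RConst 10 0), Do (RAdd 9 9 6)]"

definition sample_end :: prog where
  "sample_end = [Do (NConst 5 0), Do (NConst 6 0), Do (RConst 9 0), Do (RAdd 8 8 6)]"

definition sample :: prog where
  "sample = Do (NAdd 5 0 8) # Do (NAdd 6 1 8) # WhileDo (RLess 9 4) walk_step # sample_end"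

definition average :: prog where
  "average = [Do (RNat 2 4), Do (RMul 2 2 8), Do (RDiv 0 7 2)]"

text \<open>On termination of this fragment \<open>R 4\<close> is \<open>S = 6 (d/\<mu>) ln (max 2 (m (d/\<mu>) / \<epsilon>))\<close>, whose ceiling
  is the length of the walks, and \<open>R 5\<close> is \<open>96 S\<^sup>2 ln S / \<epsilon>\<^sup>2\<close>, whose ceiling is the number of
  samples.\<close>
definition prepare :: prog where
  "prepare =
    [Do (Deg 3 0), Do (NAdd 4 3 3), Do (RNat 2 3), Do (RDiv 3 2 1), Do (RNat 4 2), Do (RMul 4 4 3),
     Do (RDiv 4 4 0), Do (RConst 5 2),
     IfElse (RLess 4 5) [Do (RConst 4 2)] [Do (NConst 8 0)],
     Do (RLn 4 4), Do (RMul 4 4 3), Do (RConst 5 6), Do (RMul 4 4 5),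
     Do (RLn 5 4), Do (RMul 5 5 4), Do (RMul 5 5 4), Do (RDiv 5 5 0), Do (RDiv 5 5 0),
     Do (RConst 6 96), Do (RMul 5 5 6), Do (RConst 6 1)]"

text \<open>The outer test depends on the input alone, so its branches need no common
  length.\<close>

definition solver :: prog where
  "solver = prepare @
    [IfElse (RLess 5 6) [Do (RConst 0 0)] (WhileDo (RLess 8 5) sample # average)]"

section \<open>Execution of the solver\<close>

locale solver_input =
  fixes adj :: "nat list list" and b :: "real Matrix.vec" and n d u v m :: nat and \<epsilon> \<mu> :: real
  assumes length_adj: "length adj = n" and dim_b: "dim_vec b = n"
    and lists: "\<And>i. i < n \<Longrightarrow> length (adj ! i) = d \<and> set (adj ! i) \<subseteq> {..<n}"
    and d0: "0 < d" and u: "u < n" and v: "v < n"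
begin

definition S :: real where
  "S = 6 * (real d / \<mu>) * ln (max 2 (inverse \<epsilon> * (real d / \<mu>) * real m))"

definition L :: real where
  "L = 96 * S\<^sup>2 * ln S / \<epsilon>\<^sup>2"

text \<open>The store between fragments, with scratch registers zero: positions \<open>p\<close>,
  \<open>q\<close>, accumulated sum \<open>a\<close>, \<open>i\<close> finished samples and
  \<open>j\<close> finished steps.\<close>

definition st :: "nat \<Rightarrow> nat \<Rightarrow> real \<Rightarrow> real \<Rightarrow> real \<Rightarrow> store" where
  "st p q a i j =
    ((\<lambda>_. 0)(0 := u, 1 := v, 2 := m, 3 := d, 4 := 2 * d, 5 := p, 6 := q),
     (\<lambda>_. 0)(0 := \<epsilon>, 1 := \<mu>, 2 := real d, 3 := real d / \<mu>, 4 := S, 5 := L, 6 := 1,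
       7 := a, 8 := i, 9 := j))"

text \<open>Indices from \<open>d\<close> on mean staying put, so an index uniform below
  \<open>2 d\<close> realises laziness with a single draw.\<close>

definition nb :: "nat \<Rightarrow> nat \<Rightarrow> nat" where
  "nb p k = (if k < d then adj ! p ! k else p)"

text \<open>Both walks use the same random index \<open>k\<close>; their dependence is harmless, because only the
  expectation and the range of the difference matter.\<close>
primrec walk :: "nat \<Rightarrow> nat \<Rightarrow> nat \<Rightarrow> real pmf" where
  "walk 0 p q = return_pmf 0"
| "walk (Suc t) p q = bind_pmf (pmf_of_set {..<2 * d})
     (\<lambda>k. map_pmf ((+) (b $ p - b $ q)) (walk t (nb p k) (nb q k)))"

lemma nb_less: "p < n \<Longrightarrow> nb p k < n"
  using lists[of p] by (auto simp: nb_def subset_iff)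

lemma runs_walk_step:
  assumes p: "p < n" and q: "q < n"
  shows "runs adj b 11 (2 * d + 9) walk_step (st p q a i j)
    (map_pmf (\<lambda>k. st (nb p k) (nb q k) (a + (b $ p - b $ q)) i (j + 1)) (pmf_of_set {..<2 * d}))"
  unfolding walk_step_def map_pmf_def st_def
  apply (rule runs_weaken)
    apply (rule runs_Do_det, simp add: p q dim_b, simp)+
    \<comment> \<open>Six steps follow the draw; an index below \<open>d\<close> costs at most
      \<open>d\<close> in each of the two list accesses, and the other four steps cost 1.\<close>
    apply (rule runs_Rand[where k = 6 and T = "2 * d + 4"])
      apply simp
     apply (use d0 in simp)
  subgoal for r
    apply (cases "r < d")
    subgoal
      apply (rule runs_weaken)
        apply (rule runs_If_True, simp, simp only: append.simps)
        apply (rule runs_Do_det, simp add: p q length_adj lists, simp)+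
        apply (rule runs_Nil, simp add: fun_eq_iff nb_def)
       apply simp_all
      done
    subgoal
      apply (rule runs_weaken)
        apply (rule runs_If_False, simp, simp only: append.simps)
        apply (rule runs_Do_det, simp, simp)+
        apply (rule runs_Nil, simp add: fun_eq_iff nb_def)
       apply simp_all
      done
    done
   apply simp_all
  done

text \<open>The hypothesis says that \<open>s\<close> is the ceiling of \<open>S\<close>. The
  program never rounds; it compares its counter with the real \<open>S\<close>. The final 5 is the
  failing test plus \<open>sample_end\<close>.\<close>

lemma runs_walk:
  assumes S: "\<And>j. real j < S \<longleftrightarrow> j < s"
  shows "p < n \<Longrightarrow> q < n \<Longrightarrow> j + t = s \<Longrightarrow>
    runs adj b (12 * t + 5) ((2 * d + 10) * t + 5) (WhileDo (RLess 9 4) walk_step # sample_end)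
      (st p q a i (real j)) (map_pmf (\<lambda>x. st 0 0 (a + x) (i + 1) 0) (walk t p q))"
proof (induction t arbitrary: p q j a)
  case 0
  show ?case
    unfolding st_def walk.simps map_return_pmf sample_end_def
    apply (rule runs_weaken)
      apply (rule runs_While_False, use S 0 in simp)
      apply (rule runs_Do_det, simp, simp)+
      apply (rule runs_Nil, simp add: fun_eq_iff)
     apply simp_all
    done
next
  case (Suc t)
  let ?B = "\<lambda>k. map_pmf (\<lambda>x. st 0 0 (a + (b $ p - b $ q) + x) (i + 1) 0) (walk t (nb p k) (nb q k))"
  have rec: "runs adj b (12 * t + 5) ((2 * d + 10) * t + 5) (WhileDo (RLess 9 4) walk_step # sample_end)
      (st (nb p k) (nb q k) (a + (b $ p - b $ q)) i (real j + 1)) (?B k)" for k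
    using Suc.IH[of "nb p k" "nb q k" "Suc j" "a + (b $ p - b $ q)"] Suc.prems
    by (simp add: nb_less add.commute)
  have "runs adj b (Suc (11 + (12 * t + 5))) (Suc (2 * d + 9 + ((2 * d + 10) * t + 5)))
      (WhileDo (RLess 9 4) walk_step # sample_end) (st p q a i (real j))
      (bind_pmf (pmf_of_set {..<2 * d}) ?B)"
  proof (rule runs_While_True)
    show "Defs.holds (RLess 9 4) (st p q a i (real j))"
      using S Suc.prems by (simp add: st_def)
  qed (intro runs_append[OF runs_walk_step] Suc.prems rec)
  thus ?case
    by (simp add: map_bind_pmf map_pmf_comp add.assoc algebra_simps)
qed

lemma runs_sample:
  assumes S: "\<And>j. real j < S \<longleftrightarrow> j < s"
  shows "runs adj b (12 * s + 7) ((2 * d + 10) * s + 7) sample (st 0 0 a i 0)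
    (map_pmf (\<lambda>x. st 0 0 (a + x) (i + 1) 0) (walk s u v))"
proof -
  have "runs adj b (Suc (Suc (12 * s + 5))) (1 + (1 + ((2 * d + 10) * s + 5))) sample (st 0 0 a i 0)
    (map_pmf (\<lambda>x. st 0 0 (a + x) (i + 1) 0) (walk s u v))"
    unfolding sample_def
  proof (rule runs_Do_det[OF _ _ runs_Do_det])
    show "runs adj b (12 * s + 5) ((2 * d + 10) * s + 5) (WhileDo (RLess 9 4) walk_step # sample_end)
      (st u v a i 0) (map_pmf (\<lambda>x. st 0 0 (a + x) (i + 1) 0) (walk s u v))"
      using runs_walk[OF S, of u v 0 s a i] u v by simp
    show "exec_instr adj b (NAdd 5 0 8) (st 0 0 a i 0) = return_pmf (st u 0 a i 0)"
      "exec_instr adj b (NAdd 6 1 8) (st u 0 a i 0) = return_pmf (st u v a i 0)"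
      by (simp_all add: st_def fun_eq_iff)
  qed (simp_all add: st_def)
  thus ?thesis by (rule runs_weaken) simp_all
qed

lemma runs_samples:
  assumes S: "\<And>j. real j < S \<longleftrightarrow> j < s" and L: "\<And>j. real j < L \<longleftrightarrow> j < l"
  shows "i + r = l \<Longrightarrow> runs adj b ((12 * s + 8) * r + 1) (((2 * d + 10) * s + 8) * r + 1)
    [WhileDo (RLess 8 5) sample] (st 0 0 a (real i) 0)
    (map_pmf (\<lambda>x. st 0 0 (a + x) (real l) 0) (iid_sum (walk s u v) r))"
proof (induction r arbitrary: i a)
  case 0
  have "runs adj b (Suc 0) (Suc 0) [WhileDo (RLess 8 5) sample] (st 0 0 a (real i) 0)
      (return_pmf (st 0 0 a (real l) 0))"
    by (rule runs_While_False[OF _ runs_Nil]) (use 0 L in \<open>simp_all add: st_def\<close>)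
  thus ?case by simp
next
  case (Suc r)
  let ?B = "\<lambda>x. map_pmf (\<lambda>y. st 0 0 (a + x + y) (real l) 0) (iid_sum (walk s u v) r)"
  have rec: "runs adj b ((12 * s + 8) * r + 1) (((2 * d + 10) * s + 8) * r + 1)
      [WhileDo (RLess 8 5) sample] (st 0 0 (a + x) (real i + 1) 0) (?B x)" for x
    using Suc.IH[of "Suc i" "a + x"] Suc.prems by (simp add: add.commute)
  have "runs adj b (Suc (12 * s + 7 + ((12 * s + 8) * r + 1)))
      (Suc ((2 * d + 10) * s + 7 + (((2 * d + 10) * s + 8) * r + 1)))
      [WhileDo (RLess 8 5) sample] (st 0 0 a (real i) 0) (bind_pmf (walk s u v) ?B)"
  proof (rule runs_While_True)
    show "Defs.holds (RLess 8 5) (st 0 0 a (real i) 0)"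
      using L Suc.prems by (simp add: st_def)
  qed (intro runs_append[OF runs_sample] S rec)
  thus ?case
    by (simp add: map_bind_pmf map_pmf_comp add.assoc algebra_simps)
qed

lemma runs_prepare:
  "runs adj b 22 22 prepare (init_store u v m \<epsilon> \<mu>) (return_pmf (st 0 0 0 0 0))"
proof -
  let ?x = "real m * (real d / \<mu>) / \<epsilon>"
  have x: "inverse \<epsilon> * (real d / \<mu>) * real m = ?x" by (simp add: divide_inverse mult_ac)
  show ?thesis
  proof (cases "?x < 2")
    case True
    hence S: "S = 6 * (real d / \<mu>) * ln 2"
      unfolding S_def x by simp
    show ?thesis
      unfolding prepare_def init_store_def
      apply (rule runs_weaken)
        apply (rule runs_Do_det, simp add: length_adj lists u, simp)+
        apply (rule runs_If_True, use True in simp, simp only: append.simps)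
        apply (rule runs_Do_det, simp, simp)+
        apply (rule runs_Nil)
        apply (simp add: st_def fun_eq_iff L_def S power2_eq_square mult_ac)
       apply simp_all
      done
  next
    case False
    hence S: "S = 6 * (real d / \<mu>) * ln ?x"
      unfolding S_def x by (simp add: max_def)
    show ?thesis
      unfolding prepare_def init_store_def
      apply (rule runs_weaken)
        apply (rule runs_Do_det, simp add: length_adj lists u, simp)+
        apply (rule runs_If_False, use False in simp, simp only: append.simps)
        apply (rule runs_Do_det, simp, simp)+
        apply (rule runs_Nil)
        apply (simp add: st_def fun_eq_iff L_def S power2_eq_square mult_ac)
       apply simp_all
      done
  qed
qed

lemma solver_computes_0:
  assumes "L < 1" and "24 \<le> T"
  shows "computes_within adj b solver (init_store u v m \<epsilon> \<mu>) T (return_pmf 0)"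
proof -
  define \<tau> where "\<tau> = (fst (st 0 0 0 0 0), (snd (st 0 0 0 0 0))(0 := 0))"
  have "runs adj b 2 2 [IfElse (RLess 5 6) [Do (RConst 0 0)] (WhileDo (RLess 8 5) sample # average)]
      (st 0 0 0 0 0) (return_pmf \<tau>)"
    unfolding st_def \<tau>_def
    apply (rule runs_weaken)
      apply (rule runs_If_True, use assms(1) in simp, simp only: append.simps)
      apply (rule runs_Do_det, simp, simp)+
      apply (rule runs_Nil)
      apply (simp add: fun_eq_iff)
     apply simp_all
    done
  from runs_append_return[OF runs_prepare this]
  have "runs adj b 24 24 solver (init_store u v m \<epsilon> \<mu>) (return_pmf \<tau>)"
    by (simp add: solver_def)
  from runs_imp_computes_within[OF this, of T] assms(2) show ?thesis by (simp add: \<tau>_def)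
qed

lemma solver_computes_average:
  assumes S: "\<And>j. real j < S \<longleftrightarrow> j < s" and L: "\<And>j. real j < L \<longleftrightarrow> j < l" and "1 \<le> L"
    and T: "real (((2 * d + 10) * s + 8) * l + 27) \<le> T"
  shows "computes_within adj b solver (init_store u v m \<epsilon> \<mu>) T
    (map_pmf (\<lambda>x. x / (2 * real d * real l)) (iid_sum (walk s u v) l))"
proof -
  define \<tau> where "\<tau> = (\<lambda>x. (fst (st 0 0 0 0 0), (snd (st 0 0 x (real l) 0))
    (2 := 2 * real d * real l, 0 := x / (2 * real d * real l))))"
  have avg: "runs adj b 3 3 average (st 0 0 x (real l) 0) (return_pmf (\<tau> x))" for x
    unfolding st_def \<tau>_def average_def
    apply (rule runs_weaken)
      apply (rule runs_Do_det, simp, simp)+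
      apply (rule runs_Nil)
      apply (simp add: fun_eq_iff)
     apply simp_all
    done
  let ?k = "(12 * s + 8) * l + 1" and ?T = "((2 * d + 10) * s + 8) * l + 1"
  have loop: "runs adj b ?k ?T [WhileDo (RLess 8 5) sample] (st 0 0 0 0 0)
      (map_pmf (\<lambda>x. st 0 0 x (real l) 0) (iid_sum (walk s u v) l))"
    using runs_samples[OF S L, of 0 l 0] by simp
  have "runs adj b (?k + 3) (?T + 3) (WhileDo (RLess 8 5) sample # average) (st 0 0 0 0 0)
      (map_pmf \<tau> (iid_sum (walk s u v) l))"
    using runs_append[OF loop avg] by (simp add: map_pmf_def)
  hence "runs adj b (Suc (?k + 3)) (Suc (?T + 3))
      [IfElse (RLess 5 6) [Do (RConst 0 0)] (WhileDo (RLess 8 5) sample # average)] (st 0 0 0 0 0)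
      (map_pmf \<tau> (iid_sum (walk s u v) l))"
    using \<open>1 \<le> L\<close> by (intro runs_If_False) (auto simp: st_def)
  from runs_append_return[OF runs_prepare this]
  have "runs adj b (22 + Suc (?k + 3)) (22 + Suc (?T + 3)) solver (init_store u v m \<epsilon> \<mu>)
      (map_pmf \<tau> (iid_sum (walk s u v) l))"
    by (simp add: solver_def)
  from runs_imp_computes_within[OF this, of T] T show ?thesis by (simp add: \<tau>_def map_pmf_comp)
qed

end

section \<open>Concentration and correctness\<close>

lemma finite_set_iid_sum: "finite (set_pmf W) \<Longrightarrow> finite (set_pmf (iid_sum W l))"
  by (induction l) auto

lemma expectation_bind_finite:
  fixes h :: "'b \<Rightarrow> real"
  assumes "finite (set_pmf p)" "\<And>x. x \<in> set_pmf p \<Longrightarrow> finite (set_pmf (f x))"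
  shows "measure_pmf.expectation (bind_pmf p f) h
    = measure_pmf.expectation p (\<lambda>x. measure_pmf.expectation (f x) h)"
  using assms by (subst pmf_expectation_bind[of "set_pmf p"], auto)
    (subst integral_measure_pmf[of "set_pmf p"], auto)

lemma expectation_map_plus:
  fixes c :: real
  assumes "finite (set_pmf W)"
  shows "measure_pmf.expectation (map_pmf ((+) c) W) (\<lambda>x. x) = c + measure_pmf.expectation W (\<lambda>x. x)"
proof -
  have "measure_pmf.expectation (map_pmf ((+) c) W) (\<lambda>x. x) = measure_pmf.expectation W (\<lambda>x. c + x)"
    by (rule integral_map_pmf)
  also have "\<dots> = measure_pmf.expectation W (\<lambda>_. c) + measure_pmf.expectation W (\<lambda>x. x)"
    by (intro Bochner_Integration.integral_add integrable_measure_pmf_finite assms)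
  finally show ?thesis by simp
qed

lemma iid_sum_mgf:
  assumes "finite (set_pmf W)"
  shows "measure_pmf.expectation (iid_sum W l) (\<lambda>x. exp (h * (x - real l * c)))
    = measure_pmf.expectation W (\<lambda>x. exp (h * (x - c))) ^ l"
proof (induction l)
  case (Suc l)
  let ?F = "\<lambda>x. exp (h * (x - c))"
  have "measure_pmf.expectation (iid_sum W (Suc l)) (\<lambda>x. exp (h * (x - real (Suc l) * c)))
      = measure_pmf.expectation W (\<lambda>x. measure_pmf.expectation (iid_sum W l)
          (\<lambda>y. exp (h * (x + y - real (Suc l) * c))))"
    using assms by (simp add: expectation_bind_finite finite_set_iid_sum)
  also have "\<dots> = measure_pmf.expectation W (\<lambda>x. measure_pmf.expectation (iid_sum W l)
      (\<lambda>y. ?F x * exp (h * (y - real l * c))))"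
    by (simp add: algebra_simps flip: exp_add)
  also have "\<dots> = measure_pmf.expectation W ?F * measure_pmf.expectation W ?F ^ l"
    by (simp add: Suc)
  finally show ?case by simp
qed simp

text \<open>Hoeffding's lemma for the interval from \<open>- B\<close> to \<open>B\<close>, of
  length \<open>2 B\<close>: \<open>h\<^sup>2 (2 B)\<^sup>2 / 8\<close> is the exponent.\<close>

lemma Hoeffding_mgf_bound:
  fixes W :: "real pmf"
  assumes fin: "finite (set_pmf W)" and B: "\<And>x. x \<in> set_pmf W \<Longrightarrow> \<bar>x\<bar> \<le> B" and h: "0 < h"
  shows "measure_pmf.expectation W (\<lambda>x. exp (h * (x - measure_pmf.expectation W (\<lambda>x. x))))
    \<le> exp (h\<^sup>2 * B\<^sup>2 / 2)"
proof -
  interpret interval_bounded_random_variable "measure_pmf W" "\<lambda>x. x" "- B" B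
    by unfold_locales (auto simp: AE_measure_pmf_iff abs_le_iff dest!: B)
  have "ennreal (measure_pmf.expectation W (\<lambda>x. exp (h * (x - measure_pmf.expectation W (\<lambda>x. x)))))
      = (\<integral>\<^sup>+ x. exp (h * (x - measure_pmf.expectation W (\<lambda>x. x))) \<partial>measure_pmf W)"
    using fin by (subst nn_integral_eq_integral) (auto intro: integrable_measure_pmf_finite)
  also have "\<dots> \<le> ennreal (exp (h\<^sup>2 * B\<^sup>2 / 2))"
    using Hoeffdings_lemma_nn_integral[OF h] by (simp add: power_mult_distrib mult.commute)
  finally show ?thesis by (subst (asm) ennreal_le_iff) auto
qed

lemma iid_sum_upper_tail:
  assumes fin: "finite (set_pmf W)" and B: "\<And>x. x \<in> set_pmf W \<Longrightarrow> \<bar>x\<bar> \<le> B"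
    and pos: "0 < B" "0 < l" "0 < c"
  shows "measure_pmf.prob (iid_sum W l) {x. real l * measure_pmf.expectation W (\<lambda>x. x) + c \<le> x}
    \<le> exp (- (c\<^sup>2 / (2 * real l * B\<^sup>2)))"
proof -
  define e where "e = measure_pmf.expectation W (\<lambda>x. x)"
  \<comment> \<open>This \<open>h\<close> minimises the Chernoff exponent
    \<open>- h c + l h\<^sup>2 B\<^sup>2 / 2\<close>.\<close>
  define h where "h = c / (real l * B\<^sup>2)"
  have h: "0 < h" using pos by (simp add: h_def)
  let ?I = "iid_sum W l" and ?A = "{x. real l * e + c \<le> x}"
  note int = integrable_measure_pmf_finite[OF finite_set_iid_sum[OF fin]]
  have "measure_pmf.prob ?I ?A = measure_pmf.expectation ?I (indicator ?A)"
    by simp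
  also have "\<dots> \<le> measure_pmf.expectation ?I (\<lambda>x. exp (- h * c) * exp (h * (x - real l * e)))"
  proof (intro integral_mono int)
    fix x
    have "1 \<le> exp (- h * c) * exp (h * (x - real l * e))" if "x \<in> ?A"
    proof -
      have "h * c \<le> h * (x - real l * e)" using h that by (intro mult_left_mono) auto
      thus ?thesis by (simp flip: exp_add)
    qed
    thus "indicator ?A x \<le> exp (- h * c) * exp (h * (x - real l * e))"
      by (auto simp: indicator_def)
  qed
  also have "\<dots> = exp (- h * c) * measure_pmf.expectation W (\<lambda>x. exp (h * (x - e))) ^ l"
    by (simp add: iid_sum_mgf[OF fin])
  also have "\<dots> \<le> exp (- h * c) * exp (h\<^sup>2 * B\<^sup>2 / 2) ^ l"
    using Hoeffding_mgf_bound[OF fin B h] unfolding e_def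
    by (intro mult_left_mono power_mono) (auto intro: integral_nonneg)
  also have "\<dots> = exp (- h * c + real l * (h\<^sup>2 * B\<^sup>2 / 2))"
    by (simp only: exp_add exp_of_nat_mult)
  also have "- h * c + real l * (h\<^sup>2 * B\<^sup>2 / 2) = - (c\<^sup>2 / (2 * real l * B\<^sup>2))"
    using pos by (simp add: h_def field_simps power2_eq_square)
  finally show ?thesis by (simp add: e_def)
qed

lemma iid_sum_uminus: "iid_sum (map_pmf uminus W) l = map_pmf uminus (iid_sum W l)"
  by (induction l) (simp_all add: map_bind_pmf bind_map_pmf map_pmf_comp)

text \<open>The lower tail is the upper tail of the negated variable; a union bound joins
  both.\<close>

lemma iid_sum_concentration:
  assumes fin: "finite (set_pmf W)" and B: "\<And>x. x \<in> set_pmf W \<Longrightarrow> \<bar>x\<bar> \<le> B"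
    and pos: "0 < B" "0 < l" "0 < c"
  shows "1 - 2 * exp (- (c\<^sup>2 / (2 * real l * B\<^sup>2))) \<le>
    measure_pmf.prob (iid_sum W l) {x. \<bar>x - real l * measure_pmf.expectation W (\<lambda>x. x)\<bar> \<le> c}"
proof -
  let ?e = "measure_pmf.expectation W (\<lambda>x. x)" and ?I = "iid_sum W l"
  let ?U = "{x. real l * ?e + c \<le> x}" and ?V = "{x. - (real l * ?e) + c \<le> - x}"
  let ?G = "{x. \<bar>x - real l * ?e\<bar> \<le> c}"
  have "measure_pmf.prob (iid_sum (map_pmf uminus W) l)
      {x. real l * measure_pmf.expectation (map_pmf uminus W) (\<lambda>x. x) + c \<le> x}
      \<le> exp (- (c\<^sup>2 / (2 * real l * B\<^sup>2)))"
    using fin B pos by (intro iid_sum_upper_tail) auto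
  hence V: "measure_pmf.prob ?I ?V \<le> exp (- (c\<^sup>2 / (2 * real l * B\<^sup>2)))"
    by (simp add: iid_sum_uminus vimage_def)
  have "1 = measure_pmf.prob ?I (UNIV)" by simp
  also have "\<dots> \<le> measure_pmf.prob ?I (?G \<union> (?U \<union> ?V))"
    by (intro measure_pmf.finite_measure_mono) auto
  also have "\<dots> \<le> measure_pmf.prob ?I ?G + (measure_pmf.prob ?I ?U + measure_pmf.prob ?I ?V)"
    by (intro order_trans[OF measure_Un_le] add_left_mono measure_Un_le) auto
  finally show ?thesis
    using V iid_sum_upper_tail[OF fin B pos] by simp
qed

section \<open>Range and expectation of one sample\<close>

context solver_input
begin

lemma set_uniform: "set_pmf (pmf_of_set {..<2 * d}) = {..<2 * d}"
  using d0 by (intro set_pmf_of_set) (auto simp: lessThan_empty_iff)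

lemma finite_set_walk: "finite (set_pmf (walk t p q))"
  by (induction t arbitrary: p q) (auto simp: set_uniform)

lemma abs_walk_le:
  assumes b: "\<And>p. p < n \<Longrightarrow> \<bar>b $ p\<bar> \<le> c"
  shows "p < n \<Longrightarrow> q < n \<Longrightarrow> x \<in> set_pmf (walk t p q) \<Longrightarrow> \<bar>x\<bar> \<le> real t * (2 * c)"
proof (induction t arbitrary: p q x)
  case (Suc t)
  then obtain k y where y: "y \<in> set_pmf (walk t (nb p k) (nb q k))" "x = b $ p - b $ q + y"
    by auto
  have "\<bar>y\<bar> \<le> real t * (2 * c)" using Suc.IH[OF _ _ y(1)] Suc.prems by (simp add: nb_less)
  with b[OF Suc.prems(1)] b[OF Suc.prems(2)] y(2) show ?case by (simp add: algebra_simps)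
qed simp

lemma expectation_walk_Suc:
  "measure_pmf.expectation (walk (Suc t) p q) (\<lambda>x. x) = b $ p - b $ q
    + (\<Sum>k<2 * d. measure_pmf.expectation (walk t (nb p k) (nb q k)) (\<lambda>x. x)) / (2 * real d)"
proof -
  have "measure_pmf.expectation (walk (Suc t) p q) (\<lambda>x. x)
      = (\<Sum>k<2 * d. measure_pmf.expectation (map_pmf ((+) (b $ p - b $ q)) (walk t (nb p k) (nb q k)))
          (\<lambda>x. x) /\<^sub>R real (card {..<2 * d}))"
    unfolding walk.simps
  proof (rule pmf_expectation_bind_pmf_of_set)
    show "{..<2 * d} \<noteq> {}" using d0 by (simp only: lessThan_empty_iff)
    show "finite (set_pmf (map_pmf ((+) (b $ p - b $ q)) (walk t (nb p k) (nb q k))))" for k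
      by (simp add: finite_set_walk)
  qed simp
  also have "\<dots> = (\<Sum>k<2 * d. (b $ p - b $ q
      + measure_pmf.expectation (walk t (nb p k) (nb q k)) (\<lambda>x. x)) / (2 * real d))"
    unfolding expectation_map_plus[OF finite_set_walk]
    by (simp only: real_scaleR_def card_lessThan of_nat_mult of_nat_numeral divide_real_def mult.commute)
  also have "\<dots> = (real (2 * d) * (b $ p - b $ q)
      + (\<Sum>k<2 * d. measure_pmf.expectation (walk t (nb p k) (nb q k)) (\<lambda>x. x))) / (2 * real d)"
    by (simp add: sum.distrib flip: sum_divide_distrib)
  finally show ?thesis
    using d0 by (simp add: add_divide_distrib)
qed

end

section \<open>Bias, deviation and running time\<close>

locale solver_graph = solver_input + gapped_regular_graph +
  assumes adj_list: "is_adjacency_list n E adj" and mu_eq: "\<mu> = \<mu>\<^sub>2"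
    and eps: "0 < \<epsilon>" and m_eq: "m = nnz b"
begin

text \<open>Half of the indices stay at \<open>p\<close>, the others run once through its
  neighbours. This links the program to the operator \<open>lazy\<close>.\<close>

lemma sum_nb:
  assumes p: "p < n"
  shows "(\<Sum>k<2 * d. f (nb p k)) = 2 * real d * lazy f p"
proof -
  have adj_p: "distinct (adj ! p)" "set (adj ! p) = neighbours E p" "length (adj ! p) = d"
    using adj_list lists p by (auto simp: is_adjacency_list_def)
  have "(\<Sum>k<2 * d. f (nb p k)) = (\<Sum>k<d. f (nb p k)) + (\<Sum>k\<in>{d..<2 * d}. f (nb p k))"
    by (subst sum.union_disjoint[symmetric]) (auto intro!: sum.cong)
  also have "(\<Sum>k\<in>{d..<2 * d}. f (nb p k)) = real d * f p"
    by (simp add: nb_def)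
  also have "(\<Sum>k<d. f (nb p k)) = (\<Sum>k<d. f (adj ! p ! k))"
    by (simp add: nb_def)
  also have "\<dots> = (\<Sum>j\<in>neighbours E p. f j)"
    using adj_p by (intro sum.reindex_bij_betw bij_betw_nth) auto
  finally show ?thesis
    using d0 p by (simp add: lazy_eq mv_adj_fun field_simps)
qed

lemma expectation_walk:
  assumes b: "\<And>i. i < n \<Longrightarrow> b $ i = lap y i"
  shows "p < n \<Longrightarrow> q < n \<Longrightarrow> measure_pmf.expectation (walk t p q) (\<lambda>x. x)
    = 2 * real d * ((y p - (lazy ^^ t) y p) - (y q - (lazy ^^ t) y q))"
proof (induction t arbitrary: p q)
  case (Suc t)
  let ?z = "(lazy ^^ t) y"
  have "(\<Sum>k<2 * d. measure_pmf.expectation (walk t (nb p k) (nb q k)) (\<lambda>x. x))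
      = (\<Sum>k<2 * d. 2 * real d * ((y (nb p k) - ?z (nb p k)) - (y (nb q k) - ?z (nb q k))))"
    using Suc by (intro sum.cong) (auto simp: nb_less)
  also have "\<dots> = 2 * real d * ((\<Sum>k<2 * d. y (nb p k)) - (\<Sum>k<2 * d. ?z (nb p k))
      - ((\<Sum>k<2 * d. y (nb q k)) - (\<Sum>k<2 * d. ?z (nb q k))))"
    by (simp only: sum_distrib_left[symmetric] sum_subtractf)
  also have "\<dots> = 2 * real d * (2 * real d * ((lazy y p - lazy ?z p) - (lazy y q - lazy ?z q)))"
    by (simp only: sum_nb[OF Suc.prems(1)] sum_nb[OF Suc.prems(2)]) (simp add: algebra_simps)
  finally have sum: "(\<Sum>k<2 * d. measure_pmf.expectation (walk t (nb p k) (nb q k)) (\<lambda>x. x))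
      = 2 * real d * (2 * real d * ((lazy y p - lazy ?z p) - (lazy y q - lazy ?z q)))" .
  show ?case
    unfolding expectation_walk_Suc sum using d0 Suc.prems
    by (simp add: b lap_eq_lazy field_simps)
qed simp

definition Q :: real where "Q = max 2 (inverse \<epsilon> * (real d / \<mu>) * real m)"

lemma S_eq: "S = 6 * (real d / \<mu>) * ln Q"
  by (simp add: S_def Q_def)

lemma Q_ge_2: "2 \<le> Q"
  by (simp add: Q_def)

text \<open>\<open>6 * (1 / 2) * (2 / 3) = 2\<close>, from \<open>d / \<mu> \<ge> 1 / 2\<close> and
  \<open>ln 2 \<ge> 2 / 3\<close>.\<close>

lemma S_ge_2: "2 \<le> S"
proof -
  have "1 / 2 \<le> real d / \<mu>"
    using mu_le mu_pos unfolding mu_eq by (simp add: pos_le_divide_eq)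
  moreover have "ln 2 \<le> ln Q" using Q_ge_2 by simp
  hence "2 / 3 \<le> ln Q" using ln2_ge_two_thirds by linarith
  ultimately have "(1 / 2) * (2 / 3) \<le> (real d / \<mu>) * ln Q"
    by (intro mult_mono) linarith+
  thus ?thesis by (simp add: S_eq)
qed

text \<open>\<open>\<rho> \<le> exp (- \<mu> / (2 d))\<close>, so the factor 6 in \<open>S\<close>
  gives \<open>\<rho> ^ t \<le> 1 / Q ^ 3\<close>. One power of \<open>Q\<close> absorbs
  \<open>m d / (\<mu> \<epsilon>)\<close>, the other two give \<open>1 / 4\<close>.\<close>

lemma rho_power_le:
  assumes t: "S \<le> real t"
  shows "\<rho> ^ t * (real m * (real d / \<mu>)) \<le> \<epsilon> / 4"
proof -
  have r: "0 < real d / \<mu>" using d0 mu_pos by (simp add: mu_eq)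
  have "\<rho> \<le> exp (- (1 / (2 * (real d / \<mu>))))"
    using exp_ge_add_one_self[of "- (1 / (2 * (real d / \<mu>)))"] by (simp add: \<rho>_def mu_eq)
  hence "\<rho> ^ t \<le> exp (- (1 / (2 * (real d / \<mu>)))) ^ t"
    by (intro power_mono rho_nonneg)
  also have "\<dots> = exp (- (real t / (2 * (real d / \<mu>))))"
    by (simp flip: exp_of_nat_mult)
  also have "\<dots> \<le> exp (- (S / (2 * (real d / \<mu>))))"
    unfolding exp_le_cancel_iff neg_le_iff_le using t r by (intro divide_right_mono) auto
  also have "S / (2 * (real d / \<mu>)) = 3 * ln Q"
  proof -
    have "6 * r * q / (2 * r) = 3 * q" if "0 < r" for r q :: real
      using that by simp
    from this[OF r] show ?thesis by (simp only: S_eq)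
  qed
  also have "exp (- (3 * ln Q)) = 1 / Q ^ 3"
    using Q_ge_2 exp_of_nat_mult[of 3 "ln Q"] by (simp add: exp_minus divide_inverse)
  finally have \<rho>: "\<rho> ^ t \<le> 1 / Q ^ 3" .
  have "real m * (real d / \<mu>) = \<epsilon> * (inverse \<epsilon> * (real d / \<mu>) * real m)"
    using eps by simp
  also have "\<dots> \<le> \<epsilon> * Q"
    using eps by (intro mult_left_mono) (simp_all add: Q_def)
  finally have "real m * (real d / \<mu>) \<le> \<epsilon> * Q" .
  hence "\<rho> ^ t * (real m * (real d / \<mu>)) \<le> 1 / Q ^ 3 * (\<epsilon> * Q)"
  proof (rule mult_mono[OF \<rho>])
    show "0 \<le> 1 / Q ^ 3" using Q_ge_2 by simp
    show "0 \<le> real m * (real d / \<mu>)"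
      by (rule mult_nonneg_nonneg[OF of_nat_0_le_iff less_imp_le[OF r]])
  qed
  also have "\<dots> = \<epsilon> / Q\<^sup>2"
    using Q_ge_2 by (simp add: field_simps power2_eq_square power3_eq_cube)
  also have "\<dots> \<le> \<epsilon> / 4"
    using eps Q_ge_2 power_mono[of 2 Q 2] by (intro divide_left_mono) auto
  finally show ?thesis .
qed

context
  fixes x :: "real Matrix.vec"
  assumes x: "x \<in> carrier_vec n" and Lx: "laplacian n d E *\<^sub>v x = b"
begin

abbreviation "M \<equiv> max_edge_diff E x"

lemma edge_diff_le: "{i, j} \<in> E \<Longrightarrow> \<bar>x $ i - x $ j\<bar> \<le> M"
proof -
  assume e: "{i, j} \<in> E"
  have "{\<bar>x $ i - x $ j\<bar> | i j. {i, j} \<in> E} \<subseteq> (\<lambda>(i, j). \<bar>x $ i - x $ j\<bar>) ` ({..<n} \<times> {..<n})"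
    using edge_less by fastforce
  hence "finite {\<bar>x $ i - x $ j\<bar> | i j. {i, j} \<in> E}"
    by (rule finite_subset) auto
  thus ?thesis unfolding max_edge_diff_def using e by (intro Max_ge) auto
qed

text \<open>\<open>Max\<close> is unspecified on the empty set, so an edge has to be exhibited;
  vertex 0 has one since \<open>d > 0\<close>.\<close>

lemma M_nonneg: "0 \<le> M"
proof -
  have "neighbours E 0 \<noteq> {}"
    using card_neighbours[of 0] d0 n2 by auto
  then obtain j where "{0, j} \<in> E" by (auto simp: neighbours_def)
  from edge_diff_le[OF this] show ?thesis by linarith
qed

lemma b_eq_lap: "i < n \<Longrightarrow> b $ i = lap (($) x) i"
  using laplacian_mult_index[OF x] Lx by simp

lemma abs_b_le: "i < n \<Longrightarrow> \<bar>b $ i\<bar> \<le> real d * M"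
  using abs_lap_le[of i "($) x" M] edge_diff_le by (simp add: b_eq_lap)

lemma expectation_error:
  assumes t: "S \<le> real t"
  shows "\<bar>measure_pmf.expectation (walk t u v) (\<lambda>x. x) / (2 * real d) - (x $ u - x $ v)\<bar> \<le> \<epsilon> * M / 2"
proof -
  \<comment> \<open>The contraction needs a mean-zero solution; the shift changes neither the
    Laplacian nor differences of coordinates.\<close>
  define y where "y = (\<lambda>i. x $ i - (\<Sum>i<n. x $ i) / real n)"
  have y0: "(\<Sum>i<n. y i) = 0"
    using n2 by (simp add: y_def sum_subtractf)
  have lap_y: "lap y i = b $ i" if "i < n" for i
    using that by (simp add: b_eq_lap lap_eq_sum y_def)
  have "{i. i < n \<and> lap y i \<noteq> 0} = {i. i < dim_vec b \<and> b $ i \<noteq> 0}"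
    using lap_y dim_b by auto
  hence card: "card {i. i < n \<and> lap y i \<noteq> 0} = m"
    by (simp add: m_eq nnz_def)
  have small: "\<bar>(lazy ^^ t) y w\<bar> \<le> \<epsilon> * M / 4" if "w < n" for w
  proof -
    have "\<bar>(lazy ^^ t) y w\<bar> \<le> \<rho> ^ t * (real m * (real d / \<mu>) * M)"
      using lazy_power_le[OF y0 _ M_nonneg card that] edge_diff_le by (simp add: y_def mu_eq)
    also have "\<dots> = \<rho> ^ t * (real m * (real d / \<mu>)) * M" by simp
    also have "\<dots> \<le> \<epsilon> / 4 * M"
      by (intro mult_right_mono rho_power_le t M_nonneg)
    finally show ?thesis by simp
  qed
  have "measure_pmf.expectation (walk t u v) (\<lambda>x. x) / (2 * real d) - (x $ u - x $ v)
      = (lazy ^^ t) y v - (lazy ^^ t) y u"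
    using expectation_walk[of y u v t] lap_y u v d0 by (simp add: y_def)
  with small[OF u] small[OF v] show ?thesis by linarith
qed

lemma abs_walk_le_M: "z \<in> set_pmf (walk t u v) \<Longrightarrow> \<bar>z\<bar> \<le> real t * (2 * (real d * M))"
  using abs_walk_le[OF abs_b_le u v] by blast

lemma abs_expectation_walk_le:
  "\<bar>measure_pmf.expectation (walk t u v) (\<lambda>x. x)\<bar> \<le> real t * (2 * (real d * M))"
proof -
  have "\<bar>measure_pmf.expectation (walk t u v) (\<lambda>x. x)\<bar>
      \<le> measure_pmf.expectation (walk t u v) (\<lambda>x. \<bar>x\<bar>)"
    by (rule integral_abs_bound)
  also have "\<dots> \<le> measure_pmf.expectation (walk t u v) (\<lambda>_. real t * (2 * (real d * M)))"
    using abs_walk_le_M by (intro integral_mono_AE integrable_measure_pmf_finite finite_set_walk)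
      (auto simp: AE_measure_pmf_iff)
  finally show ?thesis by simp
qed

text \<open>\<open>L < 1\<close> forces \<open>8 S \<le> \<epsilon>\<close>, as
  \<open>96 * 2 / 3 = 8\<^sup>2\<close>. The expected estimate is then itself at most half of the
  permitted error, and the bias at most the other half.\<close>

lemma zero_output_correct:
  assumes L: "L < 1"
  shows "\<bar>x $ u - x $ v\<bar> \<le> \<epsilon> * M"
proof -
  define s where "s = nat \<lceil>S\<rceil>"
  have s: "S \<le> real s" "real s \<le> 2 * S"
    using S_ge_2 unfolding s_def by linarith+
  have "ln 2 \<le> ln S" using S_ge_2 by simp
  hence "2 / 3 \<le> ln S" using ln2_ge_two_thirds by linarith
  hence "96 * S\<^sup>2 * (2 / 3) \<le> 96 * S\<^sup>2 * ln S"
    by (intro mult_left_mono) auto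
  also have "\<dots> \<le> \<epsilon>\<^sup>2"
    using L eps by (simp add: L_def field_simps)
  finally have "(8 * S)\<^sup>2 \<le> \<epsilon>\<^sup>2" by (simp add: power_mult_distrib)
  hence "8 * S \<le> \<epsilon>" by (rule power2_le_imp_le) (use eps in simp)
  with s have "real s \<le> \<epsilon> / 2" using S_ge_2 by linarith
  hence "real s * M \<le> \<epsilon> / 2 * M" by (intro mult_right_mono M_nonneg)
  moreover have "\<bar>measure_pmf.expectation (walk s u v) (\<lambda>x. x) / (2 * real d)\<bar> \<le> real s * M"
    using abs_expectation_walk_le[of s] d0 by (simp add: field_simps)
  moreover note expectation_error[OF s(1)]
  ultimately show ?thesis by linarith
qed

lemma average_correct:
  assumes L: "1 \<le> L" and s: "s = nat \<lceil>S\<rceil>" and l: "L \<le> real l"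
  shows "1 - 1 / real s \<le> measure_pmf.prob
    (map_pmf (\<lambda>z. z / (2 * real d * real l)) (iid_sum (walk s u v) l)) {\<delta>. \<bar>\<delta> - (x $ u - x $ v)\<bar> \<le> \<epsilon> * M}"
proof -
  let ?I = "iid_sum (walk s u v) l"
  define e where "e = measure_pmf.expectation (walk s u v) (\<lambda>x. x)"
  define B where "B = real s * (2 * (real d * M))"
  \<comment> \<open>Division by \<open>2 d l\<close> turns this deviation into
    \<open>\<epsilon> M / 2\<close>, the half of the error not taken by the bias.\<close>
  define c where "c = real l * (real d * \<epsilon> * M)"
  have s2: "S \<le> real s" "real s \<le> 2 * S" "2 \<le> real s"
    using S_ge_2 unfolding s by linarith+
  have l0: "0 < real l" "0 < l" using L l by auto
  have "1 - 1 / real s \<le> measure_pmf.prob ?I {z. \<bar>z - real l * e\<bar> \<le> c}"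
  proof (cases "M = 0")
    case True
    have W: "z = 0" if "z \<in> set_pmf (walk s u v)" for z
      using abs_walk_le_M[OF that] True by simp
    have "z = 0" if "z \<in> set_pmf (iid_sum (walk s u v) k)" for k z
      using that by (induction k arbitrary: z) (auto dest: W)
    moreover have "e = 0"
      using abs_expectation_walk_le[of s] True by (simp add: e_def)
    ultimately have "set_pmf ?I \<subseteq> {z. \<bar>z - real l * e\<bar> \<le> c}"
      using True by (fastforce simp: c_def)
    hence "measure_pmf.prob ?I {z. \<bar>z - real l * e\<bar> \<le> c} = 1"
      by (subst measure_pmf.prob_eq_1) (auto simp: AE_measure_pmf_iff)
    thus ?thesis by simp
  next
    case False
    with M_nonneg have M: "0 < M" by simp
    have pos: "0 < B" "0 < c"
      using M d0 s2 l0 eps by (simp_all add: B_def c_def)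
    \<comment> \<open>The exponent equals \<open>l \<epsilon>\<^sup>2 / (8 s\<^sup>2)\<close>. The
      96 in \<open>L\<close> is \<open>8 * 3 * 4\<close>, with 4 from \<open>s \<le> 2 S\<close>;
      the 3 makes the failure probability at most \<open>2 / S ^ 3 \<le> 1 / s\<close>.\<close>
    have "3 * ln S \<le> c\<^sup>2 / (2 * real l * B\<^sup>2)"
    proof -
      have "24 * (2 * S)\<^sup>2 * ln S = L * \<epsilon>\<^sup>2"
        using eps by (simp add: L_def power_mult_distrib)
      also have "\<dots> \<le> real l * \<epsilon>\<^sup>2"
        using l by (intro mult_right_mono) auto
      finally have "24 * (2 * S)\<^sup>2 * ln S \<le> real l * \<epsilon>\<^sup>2" .
      moreover have "24 * (real s)\<^sup>2 * ln S \<le> 24 * (2 * S)\<^sup>2 * ln S"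
        using s2 S_ge_2 by (intro mult_right_mono mult_left_mono power_mono) auto
      ultimately have "3 * ln S \<le> real l * \<epsilon>\<^sup>2 / (8 * (real s)\<^sup>2)"
        using s2 by (simp add: field_simps)
      also have "\<dots> = c\<^sup>2 / (2 * real l * B\<^sup>2)"
        using l0 d0 M s2 by (simp add: c_def B_def power_mult_distrib power2_eq_square)
      finally show ?thesis .
    qed
    hence "2 * exp (- (c\<^sup>2 / (2 * real l * B\<^sup>2))) \<le> 2 * exp (- (3 * ln S))" by simp
    also have "\<dots> = 2 / S ^ 3"
      using S_ge_2 exp_of_nat_mult[of 3 "ln S"] by (simp add: exp_minus divide_inverse)
    also have "\<dots> \<le> 1 / (2 * S)"
    proof -
      have "4 * S \<le> S\<^sup>2 * S"
        using S_ge_2 power_mono[of 2 S 2] by (intro mult_right_mono) auto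
      thus ?thesis
        using S_ge_2 by (simp add: field_simps power2_eq_square power3_eq_cube)
    qed
    also have "\<dots> \<le> 1 / real s"
      using s2 by (intro divide_left_mono) auto
    finally have "1 - 1 / real s \<le> 1 - 2 * exp (- (c\<^sup>2 / (2 * real l * B\<^sup>2)))" by simp
    also have "\<dots> \<le> measure_pmf.prob ?I {z. \<bar>z - real l * e\<bar> \<le> c}"
      unfolding e_def using pos l0 abs_walk_le_M
      by (intro iid_sum_concentration finite_set_walk) (auto simp: B_def)
    finally show ?thesis .
  qed
  also have "\<dots> \<le> measure_pmf.prob ?I
      {z. \<bar>z / (2 * real d * real l) - (x $ u - x $ v)\<bar> \<le> \<epsilon> * M}"
  proof (intro measure_pmf.finite_measure_mono subsetI CollectI)
    fix z assume "z \<in> {z. \<bar>z - real l * e\<bar> \<le> c}"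
    hence "\<bar>z - real l * e\<bar> / (2 * real d * real l) \<le> c / (2 * real d * real l)"
      by (intro divide_right_mono) auto
    moreover have "\<bar>z - real l * e\<bar> / (2 * real d * real l) = \<bar>z / (2 * real d * real l) - e / (2 * real d)\<bar>"
    proof -
      have "z / (2 * real d * real l) - e / (2 * real d) = (z - real l * e) / (2 * real d * real l)"
        using l0 d0 by (simp add: field_simps)
      thus ?thesis by (simp add: abs_divide)
    qed
    moreover have "c / (2 * real d * real l) = \<epsilon> * M / 2"
      using l0 d0 by (simp add: c_def)
    moreover note expectation_error[OF s2(1), folded e_def]
    ultimately show "\<bar>z / (2 * real d * real l) - (x $ u - x $ v)\<bar> \<le> \<epsilon> * M" by linarith
  qed simp
  finally show ?thesis by (simp add: vimage_def)
qed

end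

text \<open>A sample costs at most \<open>20 d s\<close> and \<open>l \<le> 2 L\<close> brings in
  \<open>2 * 96\<close>, hence \<open>3840 = 20 * 192\<close>. The 27 covers preparation, the outer
  test, the last loop test and averaging.\<close>

lemma solver_time:
  assumes s: "s = nat \<lceil>S\<rceil>" and L: "1 \<le> L" and l: "real l \<le> 2 * L"
  shows "real (((2 * d + 10) * s + 8) * l + 27)
    \<le> 3840 * (1 + real d * (1 / \<epsilon>\<^sup>2) * real s ^ 3 * ln (real s))"
proof -
  have s2: "S \<le> real s" "2 \<le> real s" using S_ge_2 unfolding s by linarith+
  have "1 \<le> real d * real s" using d0 s2 mult_mono[of 1 "real d" 1 "real s"] by simp
  moreover have "real s \<le> real d * real s" using d0 s2 by simp
  ultimately have 1: "real ((2 * d + 10) * s + 8) \<le> 20 * (real d * real s)"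
    by (simp add: algebra_simps)
  have "S\<^sup>2 * ln S \<le> (real s)\<^sup>2 * ln (real s)"
    using s2 S_ge_2 by (intro mult_mono power_mono) auto
  hence "L \<le> 96 * ((real s)\<^sup>2 * ln (real s)) / \<epsilon>\<^sup>2"
    unfolding L_def by (intro divide_right_mono) auto
  with l have "real l \<le> 192 * ((real s)\<^sup>2 * ln (real s)) / \<epsilon>\<^sup>2" by simp
  with 1 have "real ((2 * d + 10) * s + 8) * real l
      \<le> (20 * (real d * real s)) * (192 * ((real s)\<^sup>2 * ln (real s)) / \<epsilon>\<^sup>2)"
    by (intro mult_mono) auto
  also have "\<dots> = 3840 * (real d * (1 / \<epsilon>\<^sup>2) * real s ^ 3 * ln (real s))"
    by (simp add: power2_eq_square power3_eq_cube)
  finally show ?thesis by simp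
qed

end

theorem theorem2p5:
  shows "\<exists>(P :: prog) (C :: real) (K :: real). 0 < C \<and> 0 < K \<and>
    (\<forall>(n :: nat) (d :: nat) (E :: nat set set) (adj :: nat list list) (b :: real Matrix.vec)
        (u :: nat) (v :: nat) (\<epsilon> :: real) (\<mu>\<^sub>2 :: real) (s :: nat).
      2 \<le> n \<longrightarrow> regular_graph n d E \<longrightarrow> is_adjacency_list n E adj \<longrightarrow>
      b \<in> carrier_vec n \<longrightarrow> b \<bullet> all_ones n = 0 \<longrightarrow>
      u < n \<longrightarrow> v < n \<longrightarrow> 0 < \<epsilon> \<longrightarrow>
      \<mu>\<^sub>2 = real d - nth_eigenvalue (adjacency_matrix n E) 2 \<longrightarrow> 0 < \<mu>\<^sub>2 \<longrightarrow>
      s = s_param C d \<mu>\<^sub>2 \<epsilon> (nnz b) \<longrightarrow>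
      2 \<le> s \<and>
      (\<exists>D :: real pmf.
        computes_within adj b P (init_store u v (nnz b) \<epsilon> \<mu>\<^sub>2)
          (K * (1 + real d * (1 / \<epsilon>\<^sup>2) * real s ^ 3 * ln (real s))) D \<and>
        (\<forall>x \<in> carrier_vec n. laplacian n d E *\<^sub>v x = b \<longrightarrow>
          measure_pmf.prob D
            {\<delta>. \<bar>\<delta> - chi n u v \<bullet> (pseudo_inverse (laplacian n d E) *\<^sub>v b)\<bar>
                 \<le> \<epsilon> * max_edge_diff E x}
          \<ge> 1 - 1 / real s)))"
proof (rule exI[of _ solver], rule exI[of _ "6 :: real"], rule exI[of _ "3840 :: real"],
    intro conjI allI impI)
  fix n d :: nat and E :: "nat set set" and adj :: "nat list list" and b :: "real Matrix.vec"
    and u v :: nat and \<epsilon> \<mu>\<^sub>2 :: real and s :: nat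
  assume n: "2 \<le> n" and reg: "regular_graph n d E" and adj: "is_adjacency_list n E adj"
    and b: "b \<in> carrier_vec n" and u: "u < n" and v: "v < n" and eps: "0 < \<epsilon>"
    and mu: "\<mu>\<^sub>2 = real d - nth_eigenvalue (adjacency_matrix n E) 2" and mu_pos: "0 < \<mu>\<^sub>2"
    and s: "s = s_param 6 d \<mu>\<^sub>2 \<epsilon> (nnz b)"
  interpret G: gapped_regular_graph n d E
    using n reg mu mu_pos by unfold_locales auto
  have lists: "length (adj ! i) = d \<and> set (adj ! i) \<subseteq> {..<n}" if "i < n" for i
    using adj that G.card_neighbours[OF that] G.neighbours_subset[of i]
      distinct_card[of "adj ! i"] by (auto simp: is_adjacency_list_def)
  interpret solver_graph adj b n d u v "nnz b" \<epsilon> \<mu>\<^sub>2 E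
    using adj b u v eps mu lists G.d_pos
    by unfold_locales (auto simp: is_adjacency_list_def G.\<mu>\<^sub>2_def)
  have s: "s = nat \<lceil>S\<rceil>"
    by (simp add: s s_param_def S_def)
  have "2 \<le> s" using S_ge_2 unfolding s by linarith
  thus "2 \<le> s" .
  let ?P = "\<lambda>\<delta> x. \<bar>\<delta> - chi n u v \<bullet> (pseudo_inverse (laplacian n d E) *\<^sub>v b)\<bar> \<le> \<epsilon> * max_edge_diff E x"
  let ?T = "3840 * (1 + real d * (1 / \<epsilon>\<^sup>2) * real s ^ 3 * ln (real s))"
  show "\<exists>D. computes_within adj b solver (init_store u v (nnz b) \<epsilon> \<mu>\<^sub>2) ?T D \<and>
    (\<forall>x\<in>carrier_vec n. laplacian n d E *\<^sub>v x = b \<longrightarrow> 1 - 1 / real s \<le> measure_pmf.prob D {\<delta>. ?P \<delta> x})"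
  proof (cases "L < 1")
    case True
    have "0 \<le> real d * (1 / \<epsilon>\<^sup>2) * real s ^ 3 * ln (real s)"
      using \<open>2 \<le> s\<close> by (intro mult_nonneg_nonneg) auto
    moreover have "24 \<le> 3840 * (1 + y)" if "0 \<le> y" for y :: real
      using that by simp
    ultimately have "computes_within adj b solver (init_store u v (nnz b) \<epsilon> \<mu>\<^sub>2) ?T (return_pmf 0)"
      by (intro solver_computes_0[OF True])
    moreover have "1 - 1 / real s \<le> measure_pmf.prob (return_pmf 0) {\<delta>. ?P \<delta> x}"
      if "x \<in> carrier_vec n" "laplacian n d E *\<^sub>v x = b" for x
      using zero_output_correct[OF that True] G.chi_pseudo_inverse[OF that u v]
      by (simp add: indicator_def abs_minus_commute)
    ultimately show ?thesis by blast
  next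
    case False
    define l where "l = nat \<lceil>L\<rceil>"
    have l: "L \<le> real l" "real l \<le> 2 * L" using False unfolding l_def by linarith+
    \<comment> \<open>This discharges the loop hypotheses for both \<open>S\<close> and
      \<open>L\<close>.\<close>
    have less: "real j < y \<longleftrightarrow> j < nat \<lceil>y\<rceil>" for j and y :: real
      by linarith
    have "computes_within adj b solver (init_store u v (nnz b) \<epsilon> \<mu>\<^sub>2) ?T
        (map_pmf (\<lambda>z. z / (2 * real d * real l)) (iid_sum (walk s u v) l))"
      using False l less
      by (intro solver_computes_average[where s = s and l = l] solver_time) (simp_all add: s l_def)
    moreover have "1 - 1 / real s \<le> measure_pmf.prob
        (map_pmf (\<lambda>z. z / (2 * real d * real l)) (iid_sum (walk s u v) l)) {\<delta>. ?P \<delta> x}"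
      if "x \<in> carrier_vec n" "laplacian n d E *\<^sub>v x = b" for x
      using average_correct[OF that _ s l(1)] False G.chi_pseudo_inverse[OF that u v] by simp
    ultimately show ?thesis by blast
  qed
qed simp_all

end
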